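(* Let $q>1$ and $A>0$, and set $\alpha=q/(q-1)$ and $c(A,q)=\tfrac12\big(A(4q-2)/q\big)^q$. The problem of maximizing $\det\mathscr{T}_V$ over real-valued $V\in L^q[0,1]$ with $\|V\|_{L^q}\le A$ has a unique solution $V_A$. It is given by \[ V_A=\frac{q}{4q-2}\,\Psi^{1/(q-1)}, \] where $\Psi$ solves \[ \Psi''-|\Psi|^\alpha+2H=0,\qquad \Psi(0)=0,\qquad \Psi'(0)=H-c(A,q), \] for a uniquely determined constant $H>c(A,q)$. The function $\Psi$ is non-negative on $[0,1]$. The potential $V_A$ has the following properties: - it is symmetric with respect to $t=1/2$; - it is smooth on $(0,1)$; - it is strictly increasing on $[0,1/2]$. Its behaviour at the endpoints depends on $q$: - if $1<q<2$, $V_A$ has zero derivatives at $t=0$ and $t=1$; - if $q=2$, $V_A$ has a positive derivative at $t=0$ and a negative derivative at $t=1$; - if $q>2$, $V_A$ has vertical tangents at both endpoints.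
   Context: For a real-valued potential $V\in L^q[0,1]$ ($q\ge1$), let $y_V$ be the solution of $-y''+Vy=0$ on $[0,1]$ with $y(0)=0$, $y'(0)=1$. Let $\mathscr{T}_V$ be the Schrödinger operator $\phi\mapsto-\phi''+V\phi$ on $[0,1]$ with Dirichlet conditions $\phi(0)=\phi(1)=0$. Its functional determinant is $\det\mathscr{T}_V=2y_V(1)$. For non-negative $V$ this coincides with the zeta-regularized determinant $e^{-\zeta'_{\mathscr{T}_V}(0)}$, where $\zeta_{\mathscr{T}_V}(s)=\sum_n\lambda_n^{-s}$ over the Dirichlet eigenvalues $\lambda_n$, meromorphically continued. For general $V$, $2y_V(1)$ is the continuous extension of this determinant. *)

theory Defs
  imports "HOL-Analysis.Analysis"
begin

definition Lq_on01 :: "real \<Rightarrow> (real \<Rightarrow> real) \<Rightarrow> bool" where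
  "Lq_on01 q V \<longleftrightarrow> set_borel_measurable lborel {0..1} V \<and>
     set_integrable lborel {0..1} (\<lambda>t. \<bar>V t\<bar> powr q)"

definition Lq_norm01 :: "real \<Rightarrow> (real \<Rightarrow> real) \<Rightarrow> real" where
  "Lq_norm01 q V = (LINT t:{0..1}|lborel. \<bar>V t\<bar> powr q) powr (1 / q)"

definition admissible :: "real \<Rightarrow> real \<Rightarrow> (real \<Rightarrow> real) \<Rightarrow> bool" where
  "admissible q A V \<longleftrightarrow> Lq_on01 q V \<and> Lq_norm01 q V \<le> A"

text \<open>y solves -y'' + V y = 0 on [0,1], y(0)=0, y'(0)=1, in the (Caratheodory) sense of
  the equivalent Volterra integral equation y(t) = t + int_0^t (t-s) V(s) y(s) ds.\<close>
definition y_sol :: "(real \<Rightarrow> real) \<Rightarrow> (real \<Rightarrow> real) \<Rightarrow> bool" where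
  "y_sol V y \<longleftrightarrow> continuous_on {0..1} y \<and>
     (\<forall>t\<in>{0..1}. y t = t + (LINT s:{0..t}|lborel. (t - s) * V s * y s))"

definition det_T :: "(real \<Rightarrow> real) \<Rightarrow> real" where
  "det_T V = 2 * (THE r. \<exists>y. y_sol V y \<and> y 1 = r)"

definition psi_sol :: "real \<Rightarrow> real \<Rightarrow> real \<Rightarrow> (real \<Rightarrow> real) \<Rightarrow> bool" where
  "psi_sol \<alpha> H c \<Psi> \<longleftrightarrow> (\<exists>\<Psi>'.
      (\<forall>t\<in>{0..1}. (\<Psi> has_real_derivative \<Psi>' t) (at t within {0..1}) \<and>
                   (\<Psi>' has_real_derivative (\<bar>\<Psi> t\<bar> powr \<alpha> - 2 * H)) (at t within {0..1})) \<and>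
      \<Psi> 0 = 0 \<and> \<Psi>' 0 = H - c)"

definition smooth_on :: "real set \<Rightarrow> (real \<Rightarrow> real) \<Rightarrow> bool" where
  "smooth_on S f \<longleftrightarrow> (\<forall>k. \<forall>t\<in>S. ((deriv ^^ k) f) differentiable (at t))"

end

theory Submission
  imports Defs
begin

text \<open>For \<open>V \<ge> 0\<close> the functional \<open>V \<mapsto> ln y\<^sub>V(1)\<close> is concave, so a critical point on the \<open>L\<^sup>q\<close> ball is a maximum.
  Concretely, let \<open>U = V\<^sub>A\<close>, let \<open>z\<close> be its solution and put \<open>v = \<Psi>'(0)\<close>. Energy conservation for \<open>\<Psi>\<close> gives
  \<open>2 \<Psi> z' = (\<Psi>' + v) z\<close>. Differentiating \<open>v ln (y\<^sub>V / z) + \<Psi> (y\<^sub>V' / y\<^sub>V - z' / z)\<close> and completing the square then yields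
  \<open>v ln (y\<^sub>V(1) / z(1)) \<le> \<integral> \<Psi> (V - U)\<close>. Because \<open>\<Psi>\<close> is a multiple of \<open>U\<^bsup>q-1\<^esup>\<close>, the right-hand side is at most a
  multiple of \<open>\<integral> V\<^sup>q - \<integral> U\<^sup>q \<le> 0\<close>, with equality only for \<open>V = U\<close>. A sign-changing \<open>V\<close> is dominated by its absolute value.

  The profile \<open>\<Psi> = m (1 - x\<^sup>2)\<close> is found by quadrature: \<open>x\<close> solves a first-order equation whose right-hand side is
  positive and bounded, so \<open>x\<close> is the inverse of an explicit integral. The remaining parameter is fixed
  by the intermediate value theorem.\<close>

section \<open>Primitives of integrable functions\<close>

lemma set_integrable_mult_continuous_on:
  fixes f h :: "real \<Rightarrow> real"
  assumes f_int: "set_integrable lborel {a..b} f" and h_cont: "continuous_on {a..b} h"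
  shows "set_integrable lborel {a..b} (\<lambda>s. f s * h s)"
proof -
  obtain M where h_le: "\<And>s. s \<in> {a..b} \<Longrightarrow> \<bar>h s\<bar> \<le> M"
    using continuous_on_compact_bound[OF compact_Icc h_cont] by auto
  have "(\<lambda>s. (indicator {a..b} s *\<^sub>R f s) * (indicator {a..b} s *\<^sub>R h s)) \<in> borel_measurable lborel"
    using borel_measurable_integrable[OF f_int[unfolded set_integrable_def]]
      borel_measurable_continuous_on_indicator[OF _ h_cont]
    by (intro borel_measurable_times) simp_all
  then have "set_borel_measurable lborel {a..b} (\<lambda>s. f s * h s)"
    unfolding set_borel_measurable_def
    by (rule measurable_cong[THEN iffD1, rotated]) (simp add: indicator_def)
  moreover have "AE s in lborel. s \<in> {a..b} \<longrightarrow> norm (f s * h s) \<le> norm (M * f s)"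
  proof (intro AE_I2 impI)
    fix s assume "s \<in> {a..b}"
    then have "\<bar>h s\<bar> \<le> \<bar>M\<bar>" using h_le[of s] by simp
    then show "norm (f s * h s) \<le> norm (M * f s)"
      by (simp add: abs_mult mult.commute[of "\<bar>M\<bar>"] mult_left_mono)
  qed
  ultimately show ?thesis
    using set_integrable_bound[of lborel "{a..b}" "\<lambda>s. M * f s"] f_int by blast
qed

lemma integrable_lborel_pair_mult:
  fixes f g :: "real \<Rightarrow> real"
  assumes f_int: "integrable lborel f" and g_int: "integrable lborel g"
  shows "integrable (lborel \<Otimes>\<^sub>M lborel) (\<lambda>(s, t). f s * g t)"
proof (rule lborel_pair.Fubini_integrable)
  note [measurable] = borel_measurable_integrable[OF f_int] borel_measurable_integrable[OF g_int]
  show "(\<lambda>(s, t). f s * g t) \<in> borel_measurable (lborel \<Otimes>\<^sub>M lborel)" by measurable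
qed (use f_int g_int in \<open>auto simp: abs_mult\<close>)

lemma LINT_triangle_swap:
  fixes f g :: "real \<Rightarrow> real"
  assumes f_int: "set_integrable lborel {a..b} f" and g_int: "set_integrable lborel {a..b} g"
  shows "(LINT s:{a..b}|lborel. f s * (LINT t:{s..b}|lborel. g t))
       = (LINT t:{a..b}|lborel. (LINT s:{a..t}|lborel. f s) * g t)"
proof -
  define F G where "F = (\<lambda>s. indicator {a..b} s * f s)" and "G = (\<lambda>t. indicator {a..b} t * g t)"
  have F_int: "integrable lborel F" and G_int: "integrable lborel G"
    using f_int g_int by (simp_all add: set_integrable_def F_def G_def)
  note [measurable] = borel_measurable_integrable[OF F_int] borel_measurable_integrable[OF G_int]
  have "integrable (lborel \<Otimes>\<^sub>M lborel) (\<lambda>(s, t). of_bool (s \<le> t) * (F s * G t))"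
    by (rule Bochner_Integration.integrable_bound[OF integrable_lborel_pair_mult[OF F_int G_int]])
       (auto simp: case_prod_beta)
  then have "(LINT s|lborel. LINT t|lborel. of_bool (s \<le> t) * (F s * G t))
      = (LINT t|lborel. LINT s|lborel. of_bool (s \<le> t) * (F s * G t))"
    by (rule lborel_pair.Fubini_integral[symmetric])
  moreover have "(LINT t|lborel. of_bool (s \<le> t) * (F s * G t))
      = indicator {a..b} s *\<^sub>R (f s * (LINT t:{s..b}|lborel. g t))" for s
  proof -
    have "(LINT t|lborel. of_bool (s \<le> t) * (F s * G t))
        = (LINT t|lborel. F s * (indicator {s..b} t *\<^sub>R g t))"
      by (intro Bochner_Integration.integral_cong) (auto simp: F_def G_def indicator_def)
    then show ?thesis by (simp add: F_def set_lebesgue_integral_def)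
  qed
  moreover have "(LINT s|lborel. of_bool (s \<le> t) * (F s * G t))
      = indicator {a..b} t *\<^sub>R ((LINT s:{a..t}|lborel. f s) * g t)" for t
  proof -
    have "(LINT s|lborel. of_bool (s \<le> t) * (F s * G t))
        = (LINT s|lborel. (indicator {a..t} s *\<^sub>R f s) * G t)"
      by (intro Bochner_Integration.integral_cong) (auto simp: F_def G_def indicator_def)
    then show ?thesis by (simp add: G_def set_lebesgue_integral_def)
  qed
  ultimately show ?thesis by (simp add: set_lebesgue_integral_def)
qed

text \<open>\<open>F\<close> is absolutely continuous on \<open>[a, b]\<close> with derivative \<open>f\<close> almost everywhere.\<close>
definition primitive_on :: "real \<Rightarrow> real \<Rightarrow> (real \<Rightarrow> real) \<Rightarrow> (real \<Rightarrow> real) \<Rightarrow> bool" where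
  "primitive_on a b f F \<longleftrightarrow> set_integrable lborel {a..b} f \<and>
     (\<forall>t\<in>{a..b}. (LINT s:{a..t}|lborel. f s) = F t - F a)"

lemma primitive_on_imp_set_integrable:
  "primitive_on a b f F \<Longrightarrow> set_integrable lborel {a..b} f"
  by (simp add: primitive_on_def)

lemma LINT_Icc_combine:
  fixes f :: "real \<Rightarrow> real"
  assumes "set_integrable lborel {a..b} f" "a \<le> s" "s \<le> t" "t \<le> b"
  shows "(LINT x:{a..t}|lborel. f x) = (LINT x:{a..s}|lborel. f x) + (LINT x:{s..t}|lborel. f x)"
proof -
  have "(LINT x:{a..s} \<union> {s..t}|lborel. f x) = (LINT x:{a..s}|lborel. f x) + (LINT x:{s..t}|lborel. f x)"
  proof (rule set_integral_Un_AE)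
    show "AE x in lborel. \<not> (x \<in> {a..s} \<and> x \<in> {s..t})"
      using AE_lborel_singleton[of s] by eventually_elim auto
  qed (use assms in \<open>auto intro: set_integrable_subset[OF assms(1)]\<close>)
  then show ?thesis using assms by (simp add: ivl_disj_un_two_touch)
qed

lemma primitive_on_LINT_eq:
  assumes "primitive_on a b f F" "a \<le> s" "s \<le> t" "t \<le> b"
  shows "(LINT x:{s..t}|lborel. f x) = F t - F s"
proof -
  have "(LINT x:{a..t}|lborel. f x) = F t - F a" "(LINT x:{a..s}|lborel. f x) = F s - F a"
    using assms by (auto simp: primitive_on_def)
  then show ?thesis using LINT_Icc_combine[of a b f s t] assms by (simp add: primitive_on_def)
qed

lemma LINT_lborel_singleton: "(LINT s:{a}|lborel. f s) = (0 :: real)" for a :: real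
  using AE_lborel_singleton[of a]
  by (auto simp: set_lebesgue_integral_def intro!: integral_eq_zero_AE elim!: eventually_mono)

lemma primitive_onI:
  assumes f_int: "set_integrable lborel {a..b} f"
    and F_eq: "\<And>t. t \<in> {a..b} \<Longrightarrow> F t = C + (LINT s:{a..t}|lborel. f s)"
  shows "primitive_on a b f F"
proof -
  have "(LINT s:{a..t}|lborel. f s) = F t - F a" if t: "t \<in> {a..b}" for t
  proof -
    have "F a = C" using F_eq[of a] t by (simp add: LINT_lborel_singleton)
    then show ?thesis using F_eq[OF t] by linarith
  qed
  then show ?thesis using f_int by (simp add: primitive_on_def)
qed

lemma primitive_on_LINT:
  "set_integrable lborel {a..b} f \<Longrightarrow> primitive_on a b f (\<lambda>t. C + (LINT s:{a..t}|lborel. f s))"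
  by (rule primitive_onI) auto

lemma primitive_on_cong:
  assumes "primitive_on a b f F" "\<And>t. t \<in> {a..b} \<Longrightarrow> g t = f t" "\<And>t. t \<in> {a..b} \<Longrightarrow> G t = F t"
  shows "primitive_on a b g G"
proof (rule primitive_onI)
  show "set_integrable lborel {a..b} g"
    using assms(1,2) set_integrable_cong[of lborel lborel "{a..b}" "{a..b}" f g]
    by (auto simp: primitive_on_def)
  show "G t = F a + (LINT s:{a..t}|lborel. g s)" if t: "t \<in> {a..b}" for t
  proof -
    have "(LINT s:{a..t}|lborel. g s) = (LINT s:{a..t}|lborel. f s)"
      by (rule set_lebesgue_integral_cong) (use assms(2) t in auto)
    then show ?thesis using assms t by (auto simp: primitive_on_def)
  qed
qed

lemma primitive_on_subinterval:
  assumes F: "primitive_on a b f F" and "a \<le> c" "d \<le> b"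
  shows "primitive_on c d f F"
proof (rule primitive_onI)
  show "set_integrable lborel {c..d} f"
    by (rule set_integrable_subset[OF primitive_on_imp_set_integrable[OF F]]) (use assms in auto)
  show "F t = F c + (LINT s:{c..t}|lborel. f s)" if "t \<in> {c..d}" for t
    using primitive_on_LINT_eq[OF F, of c t] that assms by auto
qed

lemma primitive_on_integral_eq:
  assumes F: "primitive_on a b f F" and t: "t \<in> {a..b}"
  shows "integral {a..t} f = F t - F a"
proof -
  have "set_integrable lborel {a..t} f"
    by (rule set_integrable_subset[OF primitive_on_imp_set_integrable[OF F]]) (use t in auto)
  then have "integral {a..t} f = (LINT s:{a..t}|lborel. f s)"
    by (rule set_borel_integral_eq_integral(2)[symmetric])
  then show ?thesis using F t by (simp add: primitive_on_def)
qed

lemma primitive_on_imp_continuous_on: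
  assumes F: "primitive_on a b f F"
  shows "continuous_on {a..b} F"
proof (rule continuous_on_eq)
  show "continuous_on {a..b} (\<lambda>t. F a + integral {a..t} f)"
    using set_borel_integral_eq_integral(1)[OF primitive_on_imp_set_integrable[OF F]]
    by (intro continuous_intros indefinite_integral_continuous_1)
qed (simp add: primitive_on_integral_eq[OF F])

lemma primitive_on_imp_has_real_derivative:
  assumes F: "primitive_on a b f F" and f_cont: "continuous_on {a..b} f" and t: "t \<in> {a..b}"
  shows "(F has_real_derivative f t) (at t within {a..b})"
proof (rule has_field_derivative_transform_within[where d = 1])
  show "((\<lambda>s. F a + integral {a..s} f) has_real_derivative f t) (at t within {a..b})"
    using integral_has_real_derivative[OF f_cont t] by (auto intro!: derivative_eq_intros)
qed (use t in \<open>auto simp: primitive_on_integral_eq[OF F]\<close>)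

lemma has_integral_real_derivative:
  fixes F f :: "real \<Rightarrow> real"
  assumes "a \<le> b" "\<And>t. t \<in> {a..b} \<Longrightarrow> (F has_real_derivative f t) (at t within {a..b})"
  shows "(f has_integral F b - F a) {a..b}"
  using assms
  by (intro fundamental_theorem_of_calculus) (auto simp: has_real_derivative_iff_has_vector_derivative)

lemma has_real_derivative_imp_primitive_on:
  fixes F f :: "real \<Rightarrow> real"
  assumes F_deriv: "\<And>t. t \<in> {a..b} \<Longrightarrow> (F has_real_derivative f t) (at t within {a..b})"
    and f_cont: "continuous_on {a..b} f"
  shows "primitive_on a b f F"
proof (rule primitive_onI)
  show "set_integrable lborel {a..b} f" by (rule borel_integrable_atLeastAtMost'[OF f_cont])
  fix t assume t: "t \<in> {a..b}"
  then have sub: "{a..t} \<subseteq> {a..b}" by auto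
  have "(f has_integral F t - F a) {a..t}"
    using t DERIV_subset[OF F_deriv sub] by (intro has_integral_real_derivative) auto
  moreover have "set_integrable lborel {a..t} f"
    by (rule borel_integrable_atLeastAtMost'[OF continuous_on_subset[OF f_cont sub]])
  ultimately show "F t = F a + (LINT s:{a..t}|lborel. f s)"
    by (simp add: set_borel_integral_eq_integral(2) integral_unique)
qed

lemma primitive_on_const: "primitive_on a b (\<lambda>_. 0) (\<lambda>_. C)"
  by (rule has_real_derivative_imp_primitive_on) auto

lemma primitive_on_add:
  assumes F: "primitive_on a b f F" and G: "primitive_on a b g G"
  shows "primitive_on a b (\<lambda>t. f t + g t) (\<lambda>t. F t + G t)"
proof (rule primitive_onI)
  note f_int = primitive_on_imp_set_integrable[OF F] and g_int = primitive_on_imp_set_integrable[OF G]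
  show "set_integrable lborel {a..b} (\<lambda>t. f t + g t)" using f_int g_int by (rule set_integral_add)
  fix t assume t: "t \<in> {a..b}"
  have "set_integrable lborel {a..t} f" "set_integrable lborel {a..t} g"
    using t by (auto intro: set_integrable_subset[OF f_int] set_integrable_subset[OF g_int])
  then show "F t + G t = F a + G a + (LINT s:{a..t}|lborel. f s + g s)"
    using F G t by (simp add: primitive_on_def)
qed

text \<open>The product rule is Fubini's theorem on the triangle \<open>a \<le> s \<le> r \<le> t\<close>.\<close>
lemma primitive_on_mult:
  assumes F: "primitive_on a b f F" and G: "primitive_on a b g G"
  shows "primitive_on a b (\<lambda>t. f t * G t + g t * F t) (\<lambda>t. F t * G t)"
proof (rule primitive_onI)
  note contF = primitive_on_imp_continuous_on[OF F] and contG = primitive_on_imp_continuous_on[OF G]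
  note f_int = primitive_on_imp_set_integrable[OF F] and g_int = primitive_on_imp_set_integrable[OF G]
  note fG_int = set_integrable_mult_continuous_on[OF f_int contG]
    and gF_int = set_integrable_mult_continuous_on[OF g_int contF]
  show "set_integrable lborel {a..b} (\<lambda>t. f t * G t + g t * F t)"
    using fG_int gF_int by (rule set_integral_add)
  fix t assume t: "t \<in> {a..b}"
  have restrict: "set_integrable lborel {a..t} h" if "set_integrable lborel {a..b} h" for h :: "real \<Rightarrow> real"
    by (rule set_integrable_subset[OF that]) (use t in auto)
  have G_eq: "(LINT r:{s..t}|lborel. g r) = G t - G s" if "s \<in> {a..t}" for s
    using primitive_on_LINT_eq[OF G, of s t] that t by auto
  have F_eq: "(LINT r:{a..s}|lborel. f r) = F s - F a" if "s \<in> {a..t}" for s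
    using primitive_on_LINT_eq[OF F, of a s] that t by auto
  have "(LINT s:{a..t}|lborel. f s * (LINT r:{s..t}|lborel. g r))
      = (LINT s:{a..t}|lborel. f s * G t - f s * G s)"
    by (rule set_lebesgue_integral_cong) (auto simp: G_eq algebra_simps)
  also have "\<dots> = (F t - F a) * G t - (LINT s:{a..t}|lborel. f s * G s)"
    using restrict[OF f_int] restrict[OF fG_int] F_eq[of t] t by simp
  finally have first_order: "(LINT s:{a..t}|lborel. f s * (LINT r:{s..t}|lborel. g r)) = \<dots>" .
  have "(LINT s:{a..t}|lborel. (LINT r:{a..s}|lborel. f r) * g s)
      = (LINT s:{a..t}|lborel. g s * F s - F a * g s)"
    by (rule set_lebesgue_integral_cong) (auto simp: F_eq algebra_simps)
  also have "\<dots> = (LINT s:{a..t}|lborel. g s * F s) - F a * (G t - G a)"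
    using restrict[OF g_int] restrict[OF gF_int] G_eq[of a] t by simp
  finally have "(F t - F a) * G t - (LINT s:{a..t}|lborel. f s * G s) = \<dots>"
    using first_order LINT_triangle_swap[OF restrict[OF f_int] restrict[OF g_int]] by simp
  then show "F t * G t = F a * G a + (LINT s:{a..t}|lborel. f s * G s + g s * F s)"
    using restrict[OF fG_int] restrict[OF gF_int] by (simp add: algebra_simps)
qed

lemma primitive_on_cmult:
  assumes "primitive_on a b f F"
  shows "primitive_on a b (\<lambda>t. C * f t) (\<lambda>t. C * F t)"
  using primitive_on_mult[OF primitive_on_const assms, of C] by (simp add: mult.commute)

lemma primitive_on_diff:
  assumes "primitive_on a b f F" "primitive_on a b g G"
  shows "primitive_on a b (\<lambda>t. f t - g t) (\<lambda>t. F t - G t)"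
  using primitive_on_add[OF assms(1) primitive_on_cmult[OF assms(2), of "-1"]] by simp

lemma primitive_on_power_Suc:
  assumes "primitive_on a b f F"
  shows "primitive_on a b (\<lambda>t. (real n + 1) * f t * F t ^ n) (\<lambda>t. F t ^ Suc n)"
proof (induction n)
  case 0
  then show ?case using assms by simp
next
  case (Suc n)
  show ?case
    by (rule primitive_on_cong[OF primitive_on_mult[OF assms Suc]]) (auto simp: algebra_simps)
qed

lemma primitive_on_le:
  assumes F: "primitive_on a b f F" and G: "primitive_on a b g G"
    and f_le_g: "\<And>t. t \<in> {a<..<b} \<Longrightarrow> f t \<le> g t" and "a \<le> b"
  shows "F b - F a \<le> G b - G a"
proof -
  have "AE t in lborel. t \<in> {a..b} \<longrightarrow> f t \<le> g t"
    using AE_lborel_singleton[of a] AE_lborel_singleton[of b] by eventually_elim (use f_le_g in auto)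
  then have "(LINT t:{a..b}|lborel. f t) \<le> (LINT t:{a..b}|lborel. g t)"
    using primitive_on_imp_set_integrable[OF F] primitive_on_imp_set_integrable[OF G]
    by (intro set_integral_mono_AE)
  then show ?thesis
    using \<open>a \<le> b\<close> by (simp add: primitive_on_LINT_eq[OF F] primitive_on_LINT_eq[OF G])
qed

section \<open>The Dirichlet solution as a Neumann series\<close>

definition volterra :: "(real \<Rightarrow> real) \<Rightarrow> (real \<Rightarrow> real) \<Rightarrow> real \<Rightarrow> real" where
  "volterra V u t = (LINT s:{0..t}|lborel. (t - s) * V s * u s)"

definition dirichlet_solution :: "(real \<Rightarrow> real) \<Rightarrow> real \<Rightarrow> real" where
  "dirichlet_solution V t = (\<Sum>n. (volterra V ^^ n) (\<lambda>t. t) t)"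

lemma y_sol_iff_volterra:
  "y_sol V y \<longleftrightarrow> continuous_on {0..1} y \<and> (\<forall>t\<in>{0..1}. y t = t + volterra V y t)"
  by (simp add: y_sol_def volterra_def)

lemma set_integrable_volterra_kernel:
  fixes V u :: "real \<Rightarrow> real"
  assumes V_int: "set_integrable lborel {0..1} V" and u_cont: "continuous_on {0..1} u" and t: "t \<in> {0..1}"
  shows "set_integrable lborel {0..t} (\<lambda>s. (t - s) * V s * u s)"
proof -
  have "set_integrable lborel {0..1} (\<lambda>s. V s * ((t - s) * u s))"
    by (rule set_integrable_mult_continuous_on[OF V_int]) (intro continuous_intros u_cont)
  then have "set_integrable lborel {0..t} (\<lambda>s. V s * ((t - s) * u s))"
    by (rule set_integrable_subset) (use t in auto)
  then show ?thesis by (simp add: ac_simps)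
qed

lemma volterra_diff:
  assumes "set_integrable lborel {0..1} V" "continuous_on {0..1} u" "continuous_on {0..1} w" "t \<in> {0..1}"
  shows "volterra V (\<lambda>s. u s - w s) t = volterra V u t - volterra V w t"
  using assms by (simp add: volterra_def right_diff_distrib set_integrable_volterra_kernel)

lemma primitive_on_volterra:
  assumes V_int: "set_integrable lborel {0..1} V" and u_cont: "continuous_on {0..1} u"
  shows "primitive_on 0 1 (\<lambda>r. LINT s:{0..r}|lborel. V s * u s) (volterra V u)"
proof (rule primitive_onI)
  note Vu_int = set_integrable_mult_continuous_on[OF V_int u_cont]
  show "set_integrable lborel {0..1} (\<lambda>r. LINT s:{0..r}|lborel. V s * u s)"
    using primitive_on_imp_continuous_on[OF primitive_on_LINT[OF Vu_int, of 0]]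
    by (intro borel_integrable_atLeastAtMost') simp
  fix t :: real assume t: "t \<in> {0..1}"
  have "volterra V u t = (LINT s:{0..t}|lborel. V s * u s * (LINT r:{s..t}|lborel. 1))"
    unfolding volterra_def
    by (rule set_lebesgue_integral_cong) (auto simp: set_integral_const ac_simps)
  also have "\<dots> = (LINT r:{0..t}|lborel. LINT s:{0..r}|lborel. V s * u s)"
    using t by (subst LINT_triangle_swap)
      (auto intro: set_integrable_subset[OF Vu_int] intro!: borel_integrable_atLeastAtMost'[of 0 t "\<lambda>_. 1"])
  finally show "volterra V u t = 0 + (LINT r:{0..t}|lborel. LINT s:{0..r}|lborel. V s * u s)" by simp
qed

lemma continuous_on_volterra:
  "set_integrable lborel {0..1} V \<Longrightarrow> continuous_on {0..1} u \<Longrightarrow> continuous_on {0..1} (volterra V u)"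
  by (rule primitive_on_imp_continuous_on[OF primitive_on_volterra])

lemma continuous_on_volterra_funpow:
  "set_integrable lborel {0..1} V \<Longrightarrow> continuous_on {0..1} u \<Longrightarrow> continuous_on {0..1} ((volterra V ^^ n) u)"
  by (induction n) (auto intro: continuous_on_volterra)

lemma abs_volterra_le:
  assumes V_int: "set_integrable lborel {0..1} V" and W_int: "set_integrable lborel {0..1} W"
    and u_cont: "continuous_on {0..1} u" and w_cont: "continuous_on {0..1} w" and t: "t \<in> {0..1}"
    and dominated: "\<And>s. s \<in> {0..1} \<Longrightarrow> \<bar>V s * u s\<bar> \<le> W s * w s"
  shows "\<bar>volterra V u t\<bar> \<le> volterra W w t"
proof -
  have "\<bar>volterra V u t\<bar> \<le> (LINT s:{0..t}|lborel. \<bar>(t - s) * V s * u s\<bar>)"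
    unfolding volterra_def
    using set_integral_norm_bound[OF set_integrable_volterra_kernel[OF V_int u_cont t]] by simp
  also have "\<dots> \<le> volterra W w t"
    unfolding volterra_def
  proof (intro set_integral_mono set_integrable_abs set_integrable_volterra_kernel
      V_int u_cont W_int w_cont t)
    fix s assume "s \<in> {0..t}"
    then show "\<bar>(t - s) * V s * u s\<bar> \<le> (t - s) * W s * w s"
      using dominated[of s] t by (simp add: abs_mult mult_left_mono mult.assoc)
  qed
  finally show ?thesis .
qed

definition abs_mass :: "(real \<Rightarrow> real) \<Rightarrow> real \<Rightarrow> real" where
  "abs_mass V t = (LINT s:{0..t}|lborel. \<bar>V s\<bar>)"

lemma primitive_on_abs_mass:
  "set_integrable lborel {0..1} V \<Longrightarrow> primitive_on 0 1 (\<lambda>s. \<bar>V s\<bar>) (abs_mass V)"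
  using primitive_on_LINT[of 0 1 "\<lambda>s. \<bar>V s\<bar>" 0] by (simp add: set_integrable_abs abs_mass_def[abs_def])

lemma abs_mass_0: "abs_mass V 0 = 0"
  by (simp add: abs_mass_def LINT_lborel_singleton)

lemma abs_mass_mono:
  assumes V_int: "set_integrable lborel {0..1} V" and "0 \<le> s" "s \<le> t" "t \<le> 1"
  shows "abs_mass V s \<le> abs_mass V t"
  using assms primitive_on_le[OF primitive_on_const
      primitive_on_subinterval[OF primitive_on_abs_mass[OF V_int]]]
  by fastforce

lemma volterra_abs_le_power:
  assumes V_int: "set_integrable lborel {0..1} V" and u_cont: "continuous_on {0..1} u" and t: "t \<in> {0..1}"
    and u_le: "\<And>s. s \<in> {0..1} \<Longrightarrow> \<bar>u s\<bar> \<le> C * abs_mass V s ^ n / fact n"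
  shows "volterra (\<lambda>s. \<bar>V s\<bar>) (\<lambda>s. \<bar>u s\<bar>) t \<le> C * abs_mass V t ^ Suc n / fact (Suc n)"
proof -
  have power: "primitive_on 0 1 (\<lambda>s. C / fact (Suc n) * ((real n + 1) * \<bar>V s\<bar> * abs_mass V s ^ n))
      (\<lambda>s. C / fact (Suc n) * abs_mass V s ^ Suc n)"
    by (intro primitive_on_cmult primitive_on_power_Suc primitive_on_abs_mass[OF V_int])
  have "volterra (\<lambda>s. \<bar>V s\<bar>) (\<lambda>s. \<bar>u s\<bar>) t
      \<le> (LINT s:{0..t}|lborel. C / fact (Suc n) * ((real n + 1) * \<bar>V s\<bar> * abs_mass V s ^ n))"
    unfolding volterra_def
  proof (intro set_integral_mono set_integrable_volterra_kernel set_integrable_abs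
      V_int t continuous_intros u_cont)
    show "set_integrable lborel {0..t} (\<lambda>s. C / fact (Suc n) * ((real n + 1) * \<bar>V s\<bar> * abs_mass V s ^ n))"
      by (rule set_integrable_subset[OF primitive_on_imp_set_integrable[OF power]]) (use t in auto)
    fix s assume s: "s \<in> {0..t}"
    have "(t - s) * \<bar>V s\<bar> * \<bar>u s\<bar> \<le> 1 * \<bar>V s\<bar> * \<bar>u s\<bar>"
      using s t by (intro mult_right_mono) auto
    also have "\<dots> \<le> 1 * \<bar>V s\<bar> * (C * abs_mass V s ^ n / fact n)"
      using u_le[of s] s t by (intro mult_left_mono) auto
    also have "\<dots> = C / fact (Suc n) * ((real n + 1) * \<bar>V s\<bar> * abs_mass V s ^ n)"
      by (simp add: divide_simps)
    finally show "(t - s) * \<bar>V s\<bar> * \<bar>u s\<bar> \<le> \<dots>" .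
  qed
  also have "\<dots> = C * abs_mass V t ^ Suc n / fact (Suc n)"
    using primitive_on_LINT_eq[OF power, of 0 t] t by (simp add: abs_mass_0)
  finally show ?thesis .
qed

lemma abs_volterra_le_volterra_abs:
  assumes "set_integrable lborel {0..1} V" "continuous_on {0..1} u" "t \<in> {0..1}"
  shows "\<bar>volterra V u t\<bar> \<le> volterra (\<lambda>s. \<bar>V s\<bar>) (\<lambda>s. \<bar>u s\<bar>) t"
  using assms by (intro abs_volterra_le set_integrable_abs continuous_intros) (auto simp: abs_mult)

lemma abs_volterra_funpow_le:
  assumes V_int: "set_integrable lborel {0..1} V" and u_cont: "continuous_on {0..1} u" and t: "t \<in> {0..1}"
    and u_le: "\<And>s. s \<in> {0..1} \<Longrightarrow> \<bar>u s\<bar> \<le> C"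
  shows "\<bar>(volterra V ^^ n) u t\<bar> \<le> C * abs_mass V t ^ n / fact n"
  using t
proof (induction n arbitrary: t)
  case 0
  then show ?case using u_le by simp
next
  case (Suc n)
  note cont = continuous_on_volterra_funpow[OF V_int u_cont, of n]
  have "\<bar>(volterra V ^^ Suc n) u t\<bar> \<le> volterra (\<lambda>s. \<bar>V s\<bar>) (\<lambda>s. \<bar>(volterra V ^^ n) u s\<bar>) t"
    using abs_volterra_le_volterra_abs[OF V_int cont Suc.prems] by simp
  also have "\<dots> \<le> C * abs_mass V t ^ Suc n / fact (Suc n)"
    by (rule volterra_abs_le_power[OF V_int cont Suc.prems Suc.IH])
  finally show ?case .
qed

lemma summable_power_over_fact: "summable (\<lambda>n. C * x ^ n / fact n :: real)"
  using summable_mult[OF summable_exp[of x], of C] by (simp add: field_simps)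

lemma uniform_limit_dirichlet_solution:
  assumes V_int: "set_integrable lborel {0..1} V"
  shows "uniform_limit {0..1} (\<lambda>N t. \<Sum>n<N. (volterra V ^^ n) (\<lambda>t. t) t) (dirichlet_solution V) sequentially"
  unfolding dirichlet_solution_def[abs_def]
proof (rule Weierstrass_m_test)
  show "summable (\<lambda>n. 1 * abs_mass V 1 ^ n / fact n)" by (rule summable_power_over_fact)
  fix n and t :: real assume t: "t \<in> {0..1}"
  have "\<bar>(volterra V ^^ n) (\<lambda>t. t) t\<bar> \<le> 1 * abs_mass V t ^ n / fact n"
    using t by (intro abs_volterra_funpow_le V_int) auto
  also have "\<dots> \<le> 1 * abs_mass V 1 ^ n / fact n"
    using abs_mass_mono[OF V_int, of t 1] abs_mass_mono[OF V_int, of 0 t] abs_mass_0 t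
    by (intro divide_right_mono mult_left_mono power_mono) auto
  finally show "norm ((volterra V ^^ n) (\<lambda>t. t) t) \<le> 1 * abs_mass V 1 ^ n / fact n" by simp
qed

lemma summable_abs_dirichlet_series:
  assumes "set_integrable lborel {0..1} V" "t \<in> {0..1}"
  shows "summable (\<lambda>n. \<bar>(volterra V ^^ n) (\<lambda>t. t) t\<bar>)"
  using assms abs_volterra_funpow_le[of V "\<lambda>t. t" t 1]
  by (intro summable_comparison_test'[OF summable_power_over_fact[of 1 "abs_mass V t"]]) auto

lemma volterra_suminf:
  assumes V_int: "set_integrable lborel {0..1} V"
    and u_cont: "\<And>n. continuous_on {0..1} (u n)" and t: "t \<in> {0..1}"
    and u_le: "\<And>n s. s \<in> {0..1} \<Longrightarrow> \<bar>u n s\<bar> \<le> C * abs_mass V s ^ n / fact n"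
  shows "volterra V (\<lambda>s. \<Sum>n. u n s) t = (\<Sum>n. volterra V (u n) t)"
proof -
  define kernel where "kernel = (\<lambda>n s. indicator {0..t} s *\<^sub>R ((t - s) * V s * u n s))"
  have summable: "summable (\<lambda>n. \<bar>u n s\<bar>)" if "s \<in> {0..1}" for s
    using u_le[OF that] by (intro summable_comparison_test'[OF summable_power_over_fact]) auto
  have "(LINT s|lborel. (\<Sum>n. kernel n s)) = (\<Sum>n. (LINT s|lborel. kernel n s))"
  proof (rule integral_suminf)
    show "integrable lborel (kernel n)" for n
      using set_integrable_volterra_kernel[OF V_int u_cont t] by (simp add: set_integrable_def kernel_def)
    show "AE s in lborel. summable (\<lambda>n. norm (kernel n s))"
    proof (intro AE_I2)
      show "summable (\<lambda>n. norm (kernel n s))" for s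
        using t by (cases "s \<in> {0..t}") (auto simp: kernel_def abs_mult intro!: summable_mult summable)
    qed
    have "norm (LINT s|lborel. norm (kernel n s)) \<le> C * abs_mass V t ^ Suc n / fact (Suc n)" for n
    proof -
      have "(LINT s|lborel. norm (kernel n s)) = volterra (\<lambda>s. \<bar>V s\<bar>) (\<lambda>s. \<bar>u n s\<bar>) t"
        unfolding volterra_def set_lebesgue_integral_def kernel_def
        by (intro Bochner_Integration.integral_cong) (auto simp: indicator_def abs_mult)
      also have "\<dots> \<le> C * abs_mass V t ^ Suc n / fact (Suc n)"
        by (rule volterra_abs_le_power[OF V_int u_cont t u_le])
      finally show ?thesis by simp
    qed
    moreover have "summable (\<lambda>n. C * abs_mass V t ^ Suc n / fact (Suc n))"
      by (rule summable_Suc_iff[THEN iffD2, OF summable_power_over_fact])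
    ultimately show "summable (\<lambda>n. LINT s|lborel. norm (kernel n s))"
      by (rule summable_comparison_test'[where N = 0, rotated])
  qed
  moreover have "(\<Sum>n. kernel n s) = indicator {0..t} s *\<^sub>R ((t - s) * V s * (\<Sum>n. u n s))" for s
  proof (cases "s \<in> {0..t}")
    case True
    then have "(\<Sum>n. (t - s) * V s * u n s) = (t - s) * V s * (\<Sum>n. u n s)"
      using t by (intro suminf_mult summable_rabs_cancel[OF summable]) auto
    with True show ?thesis by (simp add: kernel_def)
  qed (simp add: kernel_def)
  ultimately show ?thesis by (simp add: volterra_def set_lebesgue_integral_def kernel_def)
qed

lemma dirichlet_solution_eq:
  assumes V_int: "set_integrable lborel {0..1} V" and t: "t \<in> {0..1}"
  shows "dirichlet_solution V t = t + volterra V (dirichlet_solution V) t"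
proof -
  have "volterra V (dirichlet_solution V) t = (\<Sum>n. volterra V ((volterra V ^^ n) (\<lambda>t. t)) t)"
    unfolding dirichlet_solution_def[abs_def]
  proof (rule volterra_suminf[OF V_int _ t])
    show "continuous_on {0..1} ((volterra V ^^ n) (\<lambda>t. t))" for n
      by (intro continuous_on_volterra_funpow V_int continuous_intros)
    show "\<bar>(volterra V ^^ n) (\<lambda>t. t) s\<bar> \<le> 1 * abs_mass V s ^ n / fact n" if "s \<in> {0..1}" for n s
      using that by (intro abs_volterra_funpow_le V_int continuous_intros) auto
  qed
  moreover have "dirichlet_solution V t = (\<Sum>n. (volterra V ^^ Suc n) (\<lambda>t. t) t) + t"
    using suminf_split_head[OF summable_rabs_cancel[OF summable_abs_dirichlet_series[OF V_int t]]]
    by (simp add: dirichlet_solution_def)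
  ultimately show ?thesis by simp
qed

lemma y_sol_dirichlet_solution:
  assumes V_int: "set_integrable lborel {0..1} V"
  shows "y_sol V (dirichlet_solution V)"
  unfolding y_sol_iff_volterra
proof (intro conjI ballI dirichlet_solution_eq V_int)
  show "continuous_on {0..1} (dirichlet_solution V)"
    by (rule uniform_limit_theorem[OF _ uniform_limit_dirichlet_solution[OF V_int]])
       (auto intro!: always_eventually continuous_on_sum continuous_on_volterra_funpow[OF V_int])
qed

lemma volterra_fixed_point_eq_0:
  assumes V_int: "set_integrable lborel {0..1} V" and u_cont: "continuous_on {0..1} u"
    and fixed_point: "\<And>t. t \<in> {0..1} \<Longrightarrow> u t = volterra V u t" and t: "t \<in> {0..1}"
  shows "u t = 0"
proof -
  obtain C where u_le: "\<And>s. s \<in> {0..1} \<Longrightarrow> \<bar>u s\<bar> \<le> C"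
    using continuous_on_compact_bound[OF compact_Icc u_cont] by auto
  have "\<bar>u t\<bar> \<le> C * abs_mass V t ^ n / fact n" for n
    using t
  proof (induction n arbitrary: t)
    case (Suc n)
    have "\<bar>u t\<bar> \<le> volterra (\<lambda>s. \<bar>V s\<bar>) (\<lambda>s. \<bar>u s\<bar>) t"
      using fixed_point[OF Suc.prems] abs_volterra_le_volterra_abs[OF V_int u_cont Suc.prems] by simp
    also have "\<dots> \<le> C * abs_mass V t ^ Suc n / fact (Suc n)"
      by (rule volterra_abs_le_power[OF V_int u_cont Suc.prems Suc.IH])
    finally show ?case .
  qed (simp add: u_le)
  then have "\<bar>u t\<bar> \<le> 0"
    by (intro LIMSEQ_le_const[OF summable_LIMSEQ_zero[OF summable_power_over_fact]]) blast
  then show ?thesis by simp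
qed

lemma y_sol_unique:
  assumes V_int: "set_integrable lborel {0..1} V" and y_sol: "y_sol V y" and t: "t \<in> {0..1}"
  shows "y t = dirichlet_solution V t"
proof -
  have "y t - dirichlet_solution V t = 0"
  proof (rule volterra_fixed_point_eq_0[OF V_int _ _ t])
    show "continuous_on {0..1} (\<lambda>t. y t - dirichlet_solution V t)"
      using y_sol y_sol_dirichlet_solution[OF V_int]
      by (auto simp: y_sol_iff_volterra intro: continuous_intros)
    show "y t - dirichlet_solution V t = volterra V (\<lambda>s. y s - dirichlet_solution V s) t"
      if "t \<in> {0..1}" for t
    proof -
      have "continuous_on {0..1} y" "y t = t + volterra V y t"
        and "continuous_on {0..1} (dirichlet_solution V)"
        "dirichlet_solution V t = t + volterra V (dirichlet_solution V) t"
        using y_sol y_sol_dirichlet_solution[OF V_int] that unfolding y_sol_iff_volterra by blast+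
      then show ?thesis using volterra_diff[OF V_int _ _ that] by simp
    qed
  qed
  then show ?thesis by simp
qed

lemma det_T_eq:
  assumes V_int: "set_integrable lborel {0..1} V"
  shows "det_T V = 2 * dirichlet_solution V 1"
proof -
  have "r = dirichlet_solution V 1" if "\<exists>y. y_sol V y \<and> y 1 = r" for r
    using that y_sol_unique[OF V_int, where t = 1] by (metis atLeastAtMost_iff order_refl zero_le_one)
  then have "(THE r. \<exists>y. y_sol V y \<and> y 1 = r) = dirichlet_solution V 1"
    using y_sol_dirichlet_solution[OF V_int] by (intro the_equality exI conjI) (assumption | rule refl)+
  then show ?thesis by (simp add: det_T_def)
qed

lemma abs_dirichlet_solution_le:
  assumes V_int: "set_integrable lborel {0..1} V" and W_int: "set_integrable lborel {0..1} W"
    and V_le_W: "\<And>s. s \<in> {0..1} \<Longrightarrow> \<bar>V s\<bar> \<le> W s" and t: "t \<in> {0..1}"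
  shows "\<bar>dirichlet_solution V t\<bar> \<le> dirichlet_solution W t"
proof -
  have termwise: "\<bar>(volterra V ^^ n) (\<lambda>t. t) t\<bar> \<le> (volterra W ^^ n) (\<lambda>t. t) t" if "t \<in> {0..1}" for n t
    using that
  proof (induction n arbitrary: t)
    case (Suc n)
    have "\<bar>V s * (volterra V ^^ n) (\<lambda>t. t) s\<bar> \<le> W s * (volterra W ^^ n) (\<lambda>t. t) s" if "s \<in> {0..1}" for s
      unfolding abs_mult using V_le_W[OF that] Suc.IH[OF that] by (intro mult_mono) auto
    then show ?case
      using Suc.prems by (auto intro!: abs_volterra_le V_int W_int continuous_on_volterra_funpow)
  qed simp
  have "\<bar>dirichlet_solution V t\<bar> \<le> (\<Sum>n. \<bar>(volterra V ^^ n) (\<lambda>t. t) t\<bar>)"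
    unfolding dirichlet_solution_def by (rule summable_rabs[OF summable_abs_dirichlet_series[OF V_int t]])
  also have "\<dots> \<le> dirichlet_solution W t"
    unfolding dirichlet_solution_def
    by (intro suminf_le termwise t summable_abs_dirichlet_series V_int
        summable_rabs_cancel[OF summable_abs_dirichlet_series[OF W_int t]])
  finally show ?thesis .
qed

lemma dirichlet_solution_ge:
  assumes V_int: "set_integrable lborel {0..1} V" and "\<And>s. s \<in> {0..1} \<Longrightarrow> 0 \<le> V s" and t: "t \<in> {0..1}"
  shows "t \<le> dirichlet_solution V t"
proof -
  have int_0: "set_integrable lborel {0..1} (\<lambda>_. 0 :: real)" by (simp add: set_integrable_def)
  have "y_sol (\<lambda>_. 0) (\<lambda>t. t)" by (simp add: y_sol_iff_volterra volterra_def)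
  then have "t = dirichlet_solution (\<lambda>_. 0) t" by (rule y_sol_unique[OF int_0 _ t])
  then show ?thesis using abs_dirichlet_solution_le[OF int_0 V_int _ t] assms(2) by simp
qed

lemma set_integral_nonneg_eq_0_iff_AE:
  fixes f :: "'a \<Rightarrow> real"
  assumes "set_integrable M S f" and nonneg: "\<And>t. t \<in> S \<Longrightarrow> 0 \<le> f t"
  shows "(LINT t:S|M. f t) = 0 \<longleftrightarrow> (AE t in M. t \<in> S \<longrightarrow> f t = 0)"
proof -
  have "0 \<le> indicator S t *\<^sub>R f t" for t using nonneg by (auto simp: indicator_def)
  then have "(LINT t:S|M. f t) = 0 \<longleftrightarrow> (AE t in M. indicator S t *\<^sub>R f t = 0)"
    unfolding set_lebesgue_integral_def
    using assms(1) by (intro integral_nonneg_eq_0_iff_AE) (auto simp: set_integrable_def)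
  also have "\<dots> \<longleftrightarrow> (AE t in M. t \<in> S \<longrightarrow> f t = 0)"
    by (intro AE_cong) (auto simp: indicator_def)
  finally show ?thesis .
qed

definition dirichlet_derivative :: "(real \<Rightarrow> real) \<Rightarrow> real \<Rightarrow> real" where
  "dirichlet_derivative V t = 1 + (LINT s:{0..t}|lborel. V s * dirichlet_solution V s)"

lemma continuous_on_dirichlet_solution:
  "set_integrable lborel {0..1} V \<Longrightarrow> continuous_on {0..1} (dirichlet_solution V)"
  using y_sol_dirichlet_solution by (simp add: y_sol_iff_volterra)

lemma primitive_on_dirichlet_derivative:
  assumes V_int: "set_integrable lborel {0..1} V"
  shows "primitive_on 0 1 (\<lambda>t. V t * dirichlet_solution V t) (dirichlet_derivative V)"
  unfolding dirichlet_derivative_def[abs_def]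
  by (intro primitive_on_LINT set_integrable_mult_continuous_on continuous_on_dirichlet_solution V_int)

lemma primitive_on_dirichlet_solution:
  assumes V_int: "set_integrable lborel {0..1} V"
  shows "primitive_on 0 1 (dirichlet_derivative V) (dirichlet_solution V)"
proof (rule primitive_on_cong)
  have "primitive_on 0 1 (\<lambda>_. 1) (\<lambda>t. t)" by (rule has_real_derivative_imp_primitive_on) auto
  then show "primitive_on 0 1 (\<lambda>t. 1 + (LINT s:{0..t}|lborel. V s * dirichlet_solution V s))
      (\<lambda>t. t + volterra V (dirichlet_solution V) t)"
    by (intro primitive_on_add primitive_on_volterra continuous_on_dirichlet_solution V_int)
qed (simp_all add: dirichlet_derivative_def dirichlet_solution_eq[OF V_int, symmetric])

lemma continuous_on_dirichlet_derivative:
  "set_integrable lborel {0..1} V \<Longrightarrow> continuous_on {0..1} (dirichlet_derivative V)"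
  by (rule primitive_on_imp_continuous_on[OF primitive_on_dirichlet_derivative])

lemma dirichlet_solution_0:
  "set_integrable lborel {0..1} V \<Longrightarrow> dirichlet_solution V 0 = 0"
  using dirichlet_solution_eq[of V 0] by (simp add: volterra_def LINT_lborel_singleton)

lemma dirichlet_derivative_0: "dirichlet_derivative V 0 = 1"
  by (simp add: dirichlet_derivative_def LINT_lborel_singleton)

lemma AE_mult_dirichlet_solution_eq_abs:
  assumes V_int: "set_integrable lborel {0..1} V"
    and endpoint_eq: "dirichlet_solution V 1 = dirichlet_solution (\<lambda>t. \<bar>V t\<bar>) 1"
  shows "AE s in lborel. s \<in> {0..1} \<longrightarrow>
    V s * dirichlet_solution V s = \<bar>V s\<bar> * dirichlet_solution (\<lambda>t. \<bar>V t\<bar>) s"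
proof -
  define y Y where "y = dirichlet_solution V" and "Y = dirichlet_solution (\<lambda>t. \<bar>V t\<bar>)"
  note abs_V_int = set_integrable_abs[OF V_int]
  have kernels_int: "set_integrable lborel {0..1} (\<lambda>s. (1 - s) * \<bar>V s\<bar> * Y s)"
    "set_integrable lborel {0..1} (\<lambda>s. (1 - s) * V s * y s)"
    unfolding y_def Y_def using V_int
    by (auto intro!: set_integrable_volterra_kernel continuous_on_dirichlet_solution abs_V_int)
  have "(LINT s:{0..1}|lborel. (1 - s) * \<bar>V s\<bar> * Y s - (1 - s) * V s * y s)
      = volterra (\<lambda>t. \<bar>V t\<bar>) Y 1 - volterra V y 1"
    using kernels_int by (simp add: volterra_def)
  also have "\<dots> = 0"
    unfolding y_def Y_def
    using dirichlet_solution_eq[OF V_int, of 1] dirichlet_solution_eq[OF abs_V_int, of 1] endpoint_eq by simp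
  finally have "AE s in lborel. s \<in> {0..1} \<longrightarrow> (1 - s) * \<bar>V s\<bar> * Y s - (1 - s) * V s * y s = 0"
  proof (rule set_integral_nonneg_eq_0_iff_AE[THEN iffD1, rotated -1])
    fix s :: real assume s: "s \<in> {0..1}"
    have "V s * y s \<le> \<bar>V s\<bar> * \<bar>y s\<bar>" by (metis abs_ge_self abs_mult)
    also have "\<dots> \<le> \<bar>V s\<bar> * Y s"
      unfolding y_def Y_def
      using abs_dirichlet_solution_le[OF V_int abs_V_int _ s] by (intro mult_left_mono) auto
    finally have "(1 - s) * (V s * y s) \<le> (1 - s) * (\<bar>V s\<bar> * Y s)" using s by (intro mult_left_mono) auto
    then show "0 \<le> (1 - s) * \<bar>V s\<bar> * Y s - (1 - s) * V s * y s" by (simp add: mult.assoc)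
  qed (use kernels_int in auto)
  then show ?thesis
    unfolding y_def[symmetric] Y_def[symmetric]
    using AE_lborel_singleton[of 1] by eventually_elim auto
qed

lemma AE_eq_abs_if_dirichlet_solution_eq:
  assumes V_int: "set_integrable lborel {0..1} V"
    and endpoint_eq: "dirichlet_solution V 1 = dirichlet_solution (\<lambda>t. \<bar>V t\<bar>) 1"
  shows "AE t in lborel. t \<in> {0..1} \<longrightarrow> V t = \<bar>V t\<bar>"
proof -
  define y Y where "y = dirichlet_solution V" and "Y = dirichlet_solution (\<lambda>t. \<bar>V t\<bar>)"
  note abs_V_int = set_integrable_abs[OF V_int]
  have products_eq: "AE s in lborel. s \<in> {0..1} \<longrightarrow> V s * y s = \<bar>V s\<bar> * Y s"
    unfolding y_def Y_def by (rule AE_mult_dirichlet_solution_eq_abs[OF V_int endpoint_eq])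
  have y_eq_Y: "y t = Y t" if t: "t \<in> {0..1}" for t
  proof -
    have "set_integrable lborel {0..t} (\<lambda>s. (t - s) * V s * y s)"
      "set_integrable lborel {0..t} (\<lambda>s. (t - s) * \<bar>V s\<bar> * Y s)"
      unfolding y_def Y_def using t
      by (auto intro!: set_integrable_volterra_kernel continuous_on_dirichlet_solution V_int abs_V_int)
    then have "volterra V y t = volterra (\<lambda>s. \<bar>V s\<bar>) Y t"
      unfolding volterra_def set_lebesgue_integral_def set_integrable_def
      using products_eq t
      by (intro integral_cong_AE borel_measurable_integrable)
        (auto elim!: eventually_mono simp: indicator_def mult.assoc)
    then show ?thesis
      unfolding y_def Y_def
      using dirichlet_solution_eq[OF V_int t] dirichlet_solution_eq[OF abs_V_int t] by simp
  qed
  show ?thesis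
    using products_eq AE_lborel_singleton[of 0]
  proof eventually_elim
    case (elim t)
    have "V t = \<bar>V t\<bar>" if t: "t \<in> {0..1}"
    proof -
      have "Y t > 0" unfolding Y_def using dirichlet_solution_ge[OF abs_V_int _ t] t elim by auto
      then show ?thesis using elim t y_eq_Y[OF t] by simp
    qed
    then show ?case ..
  qed
qed

section \<open>Logarithmic comparison\<close>

lemma primitive_on_logarithmic_derivative:
  assumes y': "primitive_on a b (\<lambda>t. V t * y t) y'" and y: "primitive_on a b y' y"
    and y_nonzero: "\<And>t. t \<in> {a..b} \<Longrightarrow> y t \<noteq> 0"
  shows "primitive_on a b (\<lambda>t. V t - (y' t / y t)\<^sup>2) (\<lambda>t. y' t / y t)"
proof -
  note cont = primitive_on_imp_continuous_on[OF y] primitive_on_imp_continuous_on[OF y']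
  have "primitive_on a b (\<lambda>t. - (y' t / (y t)\<^sup>2)) (\<lambda>t. 1 / y t)"
  proof (rule has_real_derivative_imp_primitive_on)
    show "((\<lambda>t. 1 / y t) has_real_derivative - (y' t / (y t)\<^sup>2)) (at t within {a..b})" if "t \<in> {a..b}" for t
      using primitive_on_imp_has_real_derivative[OF y cont(2) that] y_nonzero[OF that]
      by (auto intro!: derivative_eq_intros simp: power2_eq_square)
    show "continuous_on {a..b} (\<lambda>t. - (y' t / (y t)\<^sup>2))"
      using y_nonzero by (intro continuous_intros cont) auto
  qed
  from primitive_on_mult[OF y' this] show ?thesis
    by (rule primitive_on_cong) (use y_nonzero in \<open>auto simp: power2_eq_square field_simps\<close>)
qed

lemma primitive_on_ln_diff:
  assumes y: "primitive_on a b y' y" "continuous_on {a..b} y'" "\<And>t. t \<in> {a..b} \<Longrightarrow> 0 < y t"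
    and z: "primitive_on a b z' z" "continuous_on {a..b} z'" "\<And>t. t \<in> {a..b} \<Longrightarrow> 0 < z t"
  shows "primitive_on a b (\<lambda>t. y' t / y t - z' t / z t) (\<lambda>t. ln (y t) - ln (z t))"
proof (rule has_real_derivative_imp_primitive_on)
  show "((\<lambda>t. ln (y t) - ln (z t)) has_real_derivative y' t / y t - z' t / z t) (at t within {a..b})"
    if "t \<in> {a..b}" for t
    using primitive_on_imp_has_real_derivative[OF y(1,2) that] y(3)[OF that]
      primitive_on_imp_has_real_derivative[OF z(1,2) that] z(3)[OF that]
    by (auto intro!: derivative_eq_intros)
  show "continuous_on {a..b} (\<lambda>t. y' t / y t - z' t / z t)"
    using y(3) z(3) primitive_on_imp_continuous_on[OF y(1)] primitive_on_imp_continuous_on[OF z(1)]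
    by (intro continuous_intros y(2) z(2)) (auto simp: less_le)
qed

definition weighted_log_ratio ::
  "real \<Rightarrow> (real \<Rightarrow> real) \<Rightarrow> (real \<Rightarrow> real) \<Rightarrow> (real \<Rightarrow> real) \<Rightarrow> (real \<Rightarrow> real) \<Rightarrow> (real \<Rightarrow> real) \<Rightarrow> real \<Rightarrow> real" where
  "weighted_log_ratio v \<Psi> y y' z z' t = v * (ln (y t) - ln (z t)) + \<Psi> t * (y' t / y t - z' t / z t)"

text \<open>With \<open>u = y'/y\<close> and \<open>w = z'/z\<close>, the hypothesis on \<open>z\<close> reads \<open>\<Psi>' + v = 2 \<Psi> w\<close>, and the weighted ratio has the
  derivative \<open>\<Psi> (V - U) - \<Psi> (u - w)\<^sup>2\<close>.\<close>
lemma weighted_log_ratio_diff_le: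
  assumes y': "primitive_on a b (\<lambda>t. V t * y t) y'" and y: "primitive_on a b y' y"
    and z': "primitive_on a b (\<lambda>t. U t * z t) z'" and z: "primitive_on a b z' z"
    and y_pos: "\<And>t. t \<in> {a..b} \<Longrightarrow> 0 < y t" and z_pos: "\<And>t. t \<in> {a..b} \<Longrightarrow> 0 < z t"
    and \<Psi>: "primitive_on a b \<Psi>' \<Psi>" and \<Psi>_nonneg: "\<And>t. t \<in> {a<..<b} \<Longrightarrow> 0 \<le> \<Psi> t"
    and riccati: "\<And>t. t \<in> {a<..<b} \<Longrightarrow> 2 * \<Psi> t * z' t = (\<Psi>' t + v) * z t"
    and F: "primitive_on a b (\<lambda>t. \<Psi> t * (V t - U t)) F" and "a \<le> b"
  shows "weighted_log_ratio v \<Psi> y y' z z' b - weighted_log_ratio v \<Psi> y y' z z' a \<le> F b - F a"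
proof (rule primitive_on_le[OF _ F _ \<open>a \<le> b\<close>])
  define u w where "u = (\<lambda>t. y' t / y t)" and "w = (\<lambda>t. z' t / z t)"
  have u: "primitive_on a b (\<lambda>t. V t - (u t)\<^sup>2) u" and w: "primitive_on a b (\<lambda>t. U t - (w t)\<^sup>2) w"
    unfolding u_def w_def
    using y_pos z_pos by (auto intro!: primitive_on_logarithmic_derivative y y' z z' simp: less_le)
  have ln_diff: "primitive_on a b (\<lambda>t. u t - w t) (\<lambda>t. ln (y t) - ln (z t))"
    unfolding u_def w_def
    using primitive_on_imp_continuous_on[OF y'] primitive_on_imp_continuous_on[OF z']
    by (intro primitive_on_ln_diff y z y_pos z_pos)
  show "primitive_on a b
      (\<lambda>t. v * (u t - w t) + (\<Psi>' t * (u t - w t) + ((V t - (u t)\<^sup>2) - (U t - (w t)\<^sup>2)) * \<Psi> t))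
      (weighted_log_ratio v \<Psi> y y' z z')"
    using primitive_on_add[OF primitive_on_cmult[OF ln_diff]
        primitive_on_mult[OF \<Psi> primitive_on_diff[OF u w]]]
    by (simp add: weighted_log_ratio_def[abs_def] u_def w_def)
  fix t assume t: "t \<in> {a<..<b}"
  have "\<Psi>' t + v = 2 * \<Psi> t * w t"
    using riccati[OF t] z_pos[of t] t by (simp add: w_def field_simps)
  then have "v * (u t - w t) + (\<Psi>' t * (u t - w t) + ((V t - (u t)\<^sup>2) - (U t - (w t)\<^sup>2)) * \<Psi> t)
      = \<Psi> t * (V t - U t) - \<Psi> t * (u t - w t)\<^sup>2"
    by algebra
  then show "v * (u t - w t) + (\<Psi>' t * (u t - w t) + ((V t - (u t)\<^sup>2) - (U t - (w t)\<^sup>2)) * \<Psi> t)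
      \<le> \<Psi> t * (V t - U t)"
    using \<Psi>_nonneg[OF t] by simp
qed

lemma continuous_on_Icc_imp_tendsto_at_right:
  fixes f :: "real \<Rightarrow> 'a :: topological_space"
  assumes "continuous_on {a..b} f" "a < b"
  shows "(f \<longlongrightarrow> f a) (at_right a)"
  using assms by (auto simp: continuous_on_def at_within_Icc_at_right dest!: bspec[where x = a])

lemma tendsto_divide_at_right_0:
  fixes f :: "real \<Rightarrow> real"
  assumes "(f has_real_derivative D) (at 0 within {0..b})" "f 0 = 0" "0 < b"
  shows "((\<lambda>t. f t / t) \<longlongrightarrow> D) (at_right 0)"
  using assms by (simp add: has_field_derivative_iff at_within_Icc_at_right)

lemma tendsto_dirichlet_solution_divide:
  assumes V_int: "set_integrable lborel {0..1} V"
  shows "((\<lambda>t. dirichlet_solution V t / t) \<longlongrightarrow> 1) (at_right 0)"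
proof (rule tendsto_divide_at_right_0)
  show "(dirichlet_solution V has_real_derivative 1) (at 0 within {0..1})"
    using primitive_on_imp_has_real_derivative[OF primitive_on_dirichlet_solution[OF V_int]
        continuous_on_dirichlet_derivative[OF V_int], of 0]
    by (simp add: dirichlet_derivative_0)
qed (simp_all add: dirichlet_solution_0[OF V_int])

lemma weighted_log_ratio_tendsto_0:
  assumes V_int: "set_integrable lborel {0..1} V" and U_int: "set_integrable lborel {0..1} U"
    and \<Psi>_quotient: "((\<lambda>t. \<Psi> t / t) \<longlongrightarrow> v) (at_right 0)"
    and pos: "\<And>t. t \<in> {0<..1} \<Longrightarrow> 0 < dirichlet_solution V t" "\<And>t. t \<in> {0<..1} \<Longrightarrow> 0 < dirichlet_solution U t"
  shows "(weighted_log_ratio v \<Psi> (dirichlet_solution V) (dirichlet_derivative V)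
    (dirichlet_solution U) (dirichlet_derivative U) \<longlongrightarrow> 0) (at_right 0)"
proof -
  define y y' z z' where "y = dirichlet_solution V" and "y' = dirichlet_derivative V"
    and "z = dirichlet_solution U" and "z' = dirichlet_derivative U"
  have y'_lim: "(y' \<longlongrightarrow> 1) (at_right 0)" and z'_lim: "(z' \<longlongrightarrow> 1) (at_right 0)"
    using continuous_on_Icc_imp_tendsto_at_right[OF continuous_on_dirichlet_derivative[OF V_int]]
      continuous_on_Icc_imp_tendsto_at_right[OF continuous_on_dirichlet_derivative[OF U_int]]
    by (simp_all add: y'_def z'_def dirichlet_derivative_0)
  have y_quotient: "((\<lambda>t. y t / t) \<longlongrightarrow> 1) (at_right 0)" and z_quotient: "((\<lambda>t. z t / t) \<longlongrightarrow> 1) (at_right 0)"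
    using tendsto_dirichlet_solution_divide[OF V_int] tendsto_dirichlet_solution_divide[OF U_int]
    by (simp_all add: y_def z_def)
  define J where
    "J = (\<lambda>t. v * (ln (y t / t) - ln (z t / t)) + \<Psi> t / t * (y' t / (y t / t) - z' t / (z t / t)))"
  have "(J \<longlongrightarrow> v * (ln 1 - ln 1) + v * (1 / 1 - 1 / 1)) (at_right 0)"
    unfolding J_def by (intro tendsto_intros y_quotient y'_lim z_quotient z'_lim \<Psi>_quotient) auto
  moreover have "\<forall>\<^sub>F t in at_right 0. J t = weighted_log_ratio v \<Psi> y y' z z' t"
    using eventually_at_right_real[OF zero_less_one]
  proof eventually_elim
    case (elim t)
    then have "0 < y t" "0 < z t" using pos by (auto simp: y_def z_def)
    then show ?case using elim by (simp add: J_def weighted_log_ratio_def ln_div field_simps)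
  qed
  ultimately show ?thesis
    using Lim_transform_eventually unfolding y_def y'_def z_def z'_def by fastforce
qed

lemma log_dirichlet_solution_comparison:
  assumes V_int: "set_integrable lborel {0..1} V" and U_int: "set_integrable lborel {0..1} U"
    and pos: "\<And>t. t \<in> {0<..1} \<Longrightarrow> 0 < dirichlet_solution V t" "\<And>t. t \<in> {0<..1} \<Longrightarrow> 0 < dirichlet_solution U t"
    and \<Psi>: "primitive_on 0 1 \<Psi>' \<Psi>" "continuous_on {0..1} \<Psi>'" "\<Psi> 0 = 0" "\<Psi> 1 = 0"
    and \<Psi>_nonneg: "\<And>t. t \<in> {0<..<1} \<Longrightarrow> 0 \<le> \<Psi> t"
    and riccati: "\<And>t. t \<in> {0<..<1} \<Longrightarrow>
      2 * \<Psi> t * dirichlet_derivative U t = (\<Psi>' t + \<Psi>' 0) * dirichlet_solution U t"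
  shows "\<Psi>' 0 * (ln (dirichlet_solution V 1) - ln (dirichlet_solution U 1))
    \<le> (LINT t:{0..1}|lborel. \<Psi> t * (V t - U t))"
proof -
  define F where "F = (\<lambda>t. LINT s:{0..t}|lborel. \<Psi> s * (V s - U s))"
  define J where "J = weighted_log_ratio (\<Psi>' 0) \<Psi> (dirichlet_solution V) (dirichlet_derivative V)
    (dirichlet_solution U) (dirichlet_derivative U)"
  have "set_integrable lborel {0..1} (\<lambda>s. (V s - U s) * \<Psi> s)"
    using primitive_on_imp_continuous_on[OF \<Psi>(1)]
    by (intro set_integrable_mult_continuous_on set_integral_diff(1) V_int U_int)
  then have "set_integrable lborel {0..1} (\<lambda>s. \<Psi> s * (V s - U s))" by (simp add: mult.commute)
  then have F: "primitive_on 0 1 (\<lambda>s. \<Psi> s * (V s - U s)) F"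
    using primitive_on_LINT[of 0 1 _ 0] by (simp add: F_def)
  have "\<forall>\<^sub>F e in at_right 0. J 1 - (F 1 - F e) \<le> J e"
    using eventually_at_right_real[OF zero_less_one]
  proof eventually_elim
    case (elim e)
    then have restrict: "primitive_on e 1 g G" if "primitive_on 0 1 g G" for g G
      using primitive_on_subinterval[OF that, of e 1] by simp
    have "J 1 - J e \<le> F 1 - F e"
      unfolding J_def
      by (rule weighted_log_ratio_diff_le[OF restrict[OF primitive_on_dirichlet_derivative[OF V_int]]
          restrict[OF primitive_on_dirichlet_solution[OF V_int]]
          restrict[OF primitive_on_dirichlet_derivative[OF U_int]]
          restrict[OF primitive_on_dirichlet_solution[OF U_int]] _ _ restrict[OF \<Psi>(1)] _ _ restrict[OF F]])
        (use elim pos \<Psi>_nonneg riccati in auto)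
    then show ?case by simp
  qed
  moreover have "((\<lambda>e. J 1 - (F 1 - F e)) \<longlongrightarrow> J 1 - (F 1 - F 0)) (at_right 0)"
    using continuous_on_Icc_imp_tendsto_at_right[OF primitive_on_imp_continuous_on[OF F]]
    by (intro tendsto_intros) simp
  moreover have "(J \<longlongrightarrow> 0) (at_right 0)"
    unfolding J_def using \<Psi> primitive_on_imp_has_real_derivative[OF \<Psi>(1,2), of 0]
    by (intro weighted_log_ratio_tendsto_0 V_int U_int pos tendsto_divide_at_right_0[where b = 1]) auto
  ultimately have "J 1 - (F 1 - F 0) \<le> 0" by (intro tendsto_le[of "at_right 0"]) auto
  then show ?thesis by (simp add: J_def weighted_log_ratio_def F_def \<Psi> LINT_lborel_singleton)
qed

text \<open>The defect \<open>M = (\<Psi>' + v) z - 2 \<Psi> z'\<close> satisfies \<open>2 \<Psi> M' = (\<Psi>' - v) M\<close>, so \<open>M\<^sup>2\<close> is nonincreasing.\<close>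
lemma riccati_of_first_integral:
  assumes U_int: "set_integrable lborel {0..1} U"
    and \<Psi>: "primitive_on 0 1 \<Psi>' \<Psi>" "primitive_on 0 1 \<Psi>'' \<Psi>'" "\<Psi> 0 = 0"
    and \<Psi>_pos: "\<And>t. t \<in> {0<..<1} \<Longrightarrow> 0 < \<Psi> t" and \<Psi>'_le: "\<And>t. t \<in> {0<..<1} \<Longrightarrow> \<Psi>' t \<le> v"
    and first_integral: "\<And>t. t \<in> {0<..<1} \<Longrightarrow> (\<Psi>' t)\<^sup>2 - 2 * \<Psi> t * \<Psi>'' t + 4 * U t * (\<Psi> t)\<^sup>2 = v\<^sup>2"
    and t: "t \<in> {0..1}"
  shows "2 * \<Psi> t * dirichlet_derivative U t = (\<Psi>' t + v) * dirichlet_solution U t"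
proof -
  define z z' where "z = dirichlet_solution U" and "z' = dirichlet_derivative U"
  define M where "M = (\<lambda>t. (\<Psi>' t + v) * z t - 2 * (\<Psi> t * z' t))"
  define M' where "M' = (\<lambda>t. z t * (\<Psi>'' t - 2 * U t * \<Psi> t) + z' t * (v - \<Psi>' t))"
  have "primitive_on 0 1 (\<lambda>t. (\<Psi>'' t + 0) * z t + z' t * (\<Psi>' t + v) - 2 * (\<Psi>' t * z' t + U t * z t * \<Psi> t)) M"
    unfolding M_def z_def z'_def
    by (intro primitive_on_diff primitive_on_cmult primitive_on_mult primitive_on_add primitive_on_const \<Psi>
        primitive_on_dirichlet_solution primitive_on_dirichlet_derivative U_int)
  then have "primitive_on 0 1 M' M"
    by (rule primitive_on_cong) (auto simp: M'_def algebra_simps)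
  then have square: "primitive_on 0 t (\<lambda>t. M' t * M t + M' t * M t) (\<lambda>t. M t * M t)"
    using primitive_on_mult[of 0 1 M' M M' M] t by (auto intro: primitive_on_subinterval)
  have "M t * M t - M 0 * M 0 \<le> 0 - 0"
  proof (rule primitive_on_le[OF square primitive_on_const])
    fix s assume "s \<in> {0<..<t}"
    then have s: "s \<in> {0<..<1}" using t by auto
    have "\<Psi> s * (M' s * M s + M' s * M s) = (\<Psi>' s - v) * (M s)\<^sup>2"
      using first_integral[OF s] unfolding M_def M'_def by algebra
    also have "\<dots> \<le> 0" using \<Psi>'_le[OF s] by (intro mult_nonpos_nonneg) auto
    finally show "M' s * M s + M' s * M s \<le> 0" using \<Psi>_pos[OF s] by (simp add: mult_le_0_iff)
  qed (use t in auto)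
  moreover have "M 0 = 0" by (simp add: M_def z_def \<Psi> dirichlet_solution_0[OF U_int])
  ultimately have "M t = 0" by (auto simp: mult_le_0_iff)
  then show ?thesis by (simp add: M_def z_def z'_def)
qed

section \<open>The power function\<close>

lemma has_real_derivative_max0_powr:
  fixes a y :: real
  assumes a_gt_1: "1 < a"
  shows "((\<lambda>y. max 0 y powr a) has_real_derivative a * max 0 y powr (a - 1)) (at y)"
proof (cases y "0::real" rule: linorder_cases)
  case less
  have "((\<lambda>y. 0) has_real_derivative 0) (at y)" by simp
  then have "((\<lambda>y. max 0 y powr a) has_real_derivative 0) (at y)"
    by (rule has_field_derivative_transform_within_open[where S = "{..<0}"]) (use less in auto)
  then show ?thesis using less by simp
next
  case greater
  have "((\<lambda>y. y powr a) has_real_derivative a * y powr (a - 1)) (at y)"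
    using greater by (intro has_real_derivative_powr) auto
  then have "((\<lambda>y. max 0 y powr a) has_real_derivative a * y powr (a - 1)) (at y)"
    by (rule has_field_derivative_transform_within_open[where S = "{0<..}"]) (use greater in auto)
  then show ?thesis using greater by simp
next
  case equal
  have "((\<lambda>y. \<bar>y\<bar> powr (a - 1)) \<longlongrightarrow> \<bar>0\<bar> powr (a - 1)) (at 0)"
    using a_gt_1 by (intro tendsto_powr' tendsto_intros) auto
  then have "((\<lambda>y. \<bar>y\<bar> powr (a - 1)) \<longlongrightarrow> 0) (at (0::real))" by simp
  moreover have "norm (max 0 y powr a / y) \<le> \<bar>y\<bar> powr (a - 1)" for y :: real
  proof (cases "0 < y")
    case False
    then have "max 0 y = 0" by simp
    then show ?thesis by simp
  qed (simp add: powr_diff)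
  then have "\<forall>\<^sub>F y in at 0. norm (max 0 y powr a / y) \<le> \<bar>y\<bar> powr (a - 1)" by simp
  ultimately have "((\<lambda>y. max 0 y powr a / y) \<longlongrightarrow> 0) (at 0)" by (rule Lim_null_comparison[rotated])
  then show ?thesis using equal a_gt_1 by (simp add: has_field_derivative_iff)
qed

lemma has_real_derivative_max0_powr_comp:
  assumes "1 < a" "(f has_real_derivative D) (at x within S)"
  shows "((\<lambda>x. max 0 (f x) powr a) has_real_derivative a * max 0 (f x) powr (a - 1) * D) (at x within S)"
  by (rule DERIV_chain2[OF has_real_derivative_max0_powr[OF assms(1)] assms(2)])

lemma continuous_on_max0_powr:
  "0 < b \<Longrightarrow> continuous_on S f \<Longrightarrow> continuous_on S (\<lambda>x. max 0 (f x) powr b :: real)"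
  by (intro continuous_on_powr' continuous_intros) auto

lemma powr_tangent_less:
  fixes u w q :: real
  assumes q_gt_1: "1 < q" and u_nonneg: "0 \<le> u" and w_nonneg: "0 \<le> w" and w_noteq_u: "w \<noteq> u"
  shows "q * u powr (q - 1) * (w - u) < w powr q - u powr q"
proof -
  note deriv = has_real_derivative_max0_powr[OF q_gt_1]
  obtain \<xi> where \<xi>: "u < \<xi> \<and> \<xi> < w \<or> w < \<xi> \<and> \<xi> < u"
    and mean: "max 0 w powr q - max 0 u powr q = (w - u) * (q * max 0 \<xi> powr (q - 1))"
  proof (cases "u < w")
    case True
    then show ?thesis using MVT2[OF True deriv] that by blast
  next
    case False
    then have "w < u" using w_noteq_u by simp
    then show ?thesis using MVT2[OF \<open>w < u\<close> deriv] that by (smt (verit) mult_minus_left)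
  qed
  have "0 < (w - u) * (\<xi> powr (q - 1) - u powr (q - 1))"
    using \<xi>
  proof
    assume "u < \<xi> \<and> \<xi> < w"
    then show ?thesis using q_gt_1 u_nonneg powr_less_mono2[of "q - 1" u \<xi>] by simp
  next
    assume "w < \<xi> \<and> \<xi> < u"
    then show ?thesis using q_gt_1 w_nonneg powr_less_mono2[of "q - 1" \<xi> u] by (simp add: mult_neg_neg)
  qed
  then have "0 < q * ((w - u) * (\<xi> powr (q - 1) - u powr (q - 1)))" using q_gt_1 by simp
  moreover have "w powr q - u powr q = q * ((w - u) * \<xi> powr (q - 1))"
    using mean u_nonneg w_nonneg \<xi> by (auto simp: mult_ac)
  ultimately show ?thesis by (simp add: algebra_simps)
qed

corollary powr_tangent_le:
  fixes u w q :: real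
  assumes "1 < q" "0 \<le> u" "0 \<le> w"
  shows "q * u powr (q - 1) * (w - u) \<le> w powr q - u powr q"
  using powr_tangent_less[OF assms] by (cases "w = u") auto

lemma set_integral_powr_tangent:
  fixes f g :: "'a \<Rightarrow> real"
  assumes q_gt_1: "1 < q" and f_nonneg: "\<And>t. t \<in> S \<Longrightarrow> 0 \<le> f t" and g_nonneg: "\<And>t. t \<in> S \<Longrightarrow> 0 \<le> g t"
    and fq_int: "set_integrable M S (\<lambda>t. f t powr q)" and gq_int: "set_integrable M S (\<lambda>t. g t powr q)"
    and pairing_int: "set_integrable M S (\<lambda>t. g t powr (q - 1) * (f t - g t))"
  shows "q * (LINT t:S|M. g t powr (q - 1) * (f t - g t))
      \<le> (LINT t:S|M. f t powr q) - (LINT t:S|M. g t powr q)" (is "?tangent \<le> ?diff")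
    and "q * (LINT t:S|M. g t powr (q - 1) * (f t - g t))
      = (LINT t:S|M. f t powr q) - (LINT t:S|M. g t powr q) \<Longrightarrow> AE t in M. t \<in> S \<longrightarrow> f t = g t"
proof -
  define gap where "gap = (\<lambda>t. (f t powr q - g t powr q) - q * (g t powr (q - 1) * (f t - g t)))"
  have gap_int: "set_integrable M S gap"
    unfolding gap_def by (intro set_integral_diff set_integrable_mult_right fq_int gq_int pairing_int)
  have gap_nonneg: "0 \<le> gap t" if "t \<in> S" for t
    using powr_tangent_le[OF q_gt_1 g_nonneg[OF that] f_nonneg[OF that]] by (simp add: gap_def mult.assoc)
  have gap_integral: "(LINT t:S|M. gap t) = ?diff - ?tangent"
    unfolding gap_def using fq_int gq_int pairing_int by simp
  have "0 \<le> (LINT t:S|M. gap t)"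
    unfolding set_lebesgue_integral_def using gap_nonneg
    by (intro integral_nonneg_AE) (auto simp: indicator_def)
  then show "?tangent \<le> ?diff" by (simp add: gap_integral)
  assume "?tangent = ?diff"
  then have "AE t in M. t \<in> S \<longrightarrow> gap t = 0"
    using set_integral_nonneg_eq_0_iff_AE[OF gap_int gap_nonneg] gap_integral by simp
  then show "AE t in M. t \<in> S \<longrightarrow> f t = g t"
  proof eventually_elim
    case (elim t)
    then show ?case
      using powr_tangent_less[OF q_gt_1 g_nonneg f_nonneg, of t t] by (auto simp: gap_def mult.assoc)
  qed
qed

section \<open>Construction of the extremal profile\<close>

lemma bij_if_derivative_bounded_below:
  fixes f f' :: "real \<Rightarrow> real"
  assumes deriv: "\<And>x. (f has_real_derivative f' x) (at x)" and "0 < \<delta>" and derivative_ge: "\<And>x. \<delta> \<le> f' x"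
  shows "bij f"
proof -
  have "strict_mono f"
  proof (rule strict_monoI)
    show "f x < f y" if "x < y" for x y
      using DERIV_pos_imp_increasing[OF that] deriv derivative_ge \<open>0 < \<delta>\<close> by (meson less_le_trans)
  qed
  have growth: "f x - \<delta> * x \<le> f y - \<delta> * y" if "x \<le> y" for x y
  proof (rule DERIV_nonneg_imp_nondecreasing[OF that])
    fix x show "\<exists>d. ((\<lambda>x. f x - \<delta> * x) has_real_derivative d) (at x) \<and> 0 \<le> d"
      using derivative_ge[of x] by (intro exI[of _ "f' x - \<delta>"]) (auto intro!: derivative_eq_intros deriv)
  qed
  have "\<exists>x. f x = y" for y
  proof -
    define b where "b = \<bar>y - f 0\<bar> / \<delta>"
    have b_props: "0 \<le> b" "\<delta> * b = \<bar>y - f 0\<bar>" using \<open>0 < \<delta>\<close> by (auto simp: b_def)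
    then have "f (- b) \<le> y" "y \<le> f b" using growth[of "- b" 0] growth[of 0 b] by auto
    moreover have "continuous_on {- b..b} f"
      using DERIV_isCont[OF deriv] by (simp add: continuous_at_imp_continuous_on)
    ultimately show ?thesis using IVT'[of f "- b" y b] b_props by auto
  qed
  then have "surj f" by (metis surjI)
  with \<open>strict_mono f\<close> show ?thesis by (simp add: bij_def strict_mono_imp_inj_on)
qed

lemma odd_if_derivative_even:
  fixes f f' :: "real \<Rightarrow> real"
  assumes deriv: "\<And>x. (f has_real_derivative f' x) (at x)" and even: "\<And>x. f' (- x) = f' x" and "f 0 = 0"
  shows "f (- x) = - f x"
proof -
  have "((\<lambda>x. f x + f (- x)) has_real_derivative 0) (at x)" for x
    using DERIV_add[OF deriv DERIV_chain2[OF deriv DERIV_minus[OF DERIV_ident]]] by (simp add: even)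
  then have "f x + f (- x) = f 0 + f (- 0)" by (intro DERIV_isconst_all) auto
  then show ?thesis using \<open>f 0 = 0\<close> by simp
qed

text \<open>Separation of variables: the solution is the inverse of \<open>T(x) = \<integral>\<^sub>0\<^sup>x 1/g\<close>.\<close>
lemma odd_autonomous_solution_exists:
  fixes g :: "real \<Rightarrow> real"
  assumes g: "continuous_on UNIV g" "\<And>x. 0 < g x" "\<And>x. g x \<le> B" and even: "\<And>x. g (- x) = g x"
  obtains X where "\<And>t. (X has_real_derivative g (X t)) (at t)" "\<And>t. X (- t) = - X t"
    "\<And>x. 0 \<le> x \<Longrightarrow> X (integral {0..x} (\<lambda>s. 1 / g s)) = x"
proof -
  have "0 < B" using g(2,3)[of 0] by linarith
  have "isCont (\<lambda>x. 1 / g x) x" for x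
    using g(1,2) by (intro continuous_intros) (auto simp: continuous_on_eq_continuous_at less_le)
  then obtain F where F: "\<And>x. (F has_real_derivative 1 / g x) (at x)"
    using einterval_antiderivative[of "- \<infinity>" \<infinity> "\<lambda>x. 1 / g x"]
    by (auto simp: has_real_derivative_iff_has_vector_derivative)
  define T where "T = (\<lambda>x. F x - F 0)"
  have deriv_T: "(T has_real_derivative 1 / g x) (at x)" for x
    unfolding T_def using F by (auto intro!: derivative_eq_intros)
  have "1 / B \<le> 1 / g x" for x using g(2,3) \<open>0 < B\<close> by (intro divide_left_mono) auto
  then have "bij T" using \<open>0 < B\<close> by (intro bij_if_derivative_bounded_below[OF deriv_T, of "1 / B"]) auto
  have T_integral: "T x = integral {0..x} (\<lambda>s. 1 / g s)" if "0 \<le> x" for x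
    using has_integral_real_derivative[OF that has_field_derivative_at_within[OF deriv_T]]
    by (simp add: T_def integral_unique)
  have T_odd: "T (- x) = - T x" for x by (rule odd_if_derivative_even[OF deriv_T]) (simp_all add: even T_def)
  define X where "X = inv T"
  have X_T: "X (T x) = x" for x unfolding X_def using \<open>bij T\<close> by (simp add: bij_is_inj)
  have T_X: "T (X t) = t" for t unfolding X_def using \<open>bij T\<close> by (simp add: bij_is_surj surj_f_inv_f)
  have "isCont X (T (X t))" for t
    by (rule isCont_inverse_function[where d = 1]) (use X_T DERIV_isCont[OF deriv_T] in auto)
  then have "isCont X t" for t by (simp add: T_X)
  then have deriv_X: "(X has_real_derivative g (X t)) (at t)" for t
    using DERIV_inverse_function[OF deriv_T, of X t "t - 1" "t + 1"] T_X g(2)[of "X t"] by simp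
  have X_odd: "X (- t) = - X t" for t using X_T[of "- X t"] by (simp add: T_odd T_X)
  show ?thesis by (rule that[of X]) (simp_all add: deriv_X X_odd X_T T_integral[symmetric])
qed

text \<open>With \<open>\<Psi> = m (1 - x\<^sup>2)\<close> and \<open>2 H = \<kappa> m\<^sup>a\<close>, the energy integral of \<open>\<Psi>'' = \<Psi>\<^sup>a - 2 H\<close> says that \<open>x'\<^sup>2\<close> is a
  constant multiple of \<open>\<kappa> - chord_slope a (x\<^sup>2)\<close>, which has no singularity at the maximum of \<open>\<Psi>\<close>.\<close>
definition chord_slope :: "real \<Rightarrow> real \<Rightarrow> real" where
  "chord_slope a s = integral {0..1} (\<lambda>r. max 0 (1 - s * r) powr a)"

definition half_time :: "real \<Rightarrow> real \<Rightarrow> real" where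
  "half_time a \<kappa> = integral {0..1} (\<lambda>x. 1 / sqrt (\<kappa> - chord_slope a (x\<^sup>2)))"

context
  fixes a :: real
  assumes a_gt_1: "1 < a"
begin

lemma mult_chord_slope:
  "s * chord_slope a s = (1 - max 0 (1 - s) powr (a + 1)) / (a + 1)"
proof -
  define F where "F = (\<lambda>r. - (max 0 (1 - s * r) powr (a + 1)) / (a + 1))"
  have "(F has_real_derivative s * max 0 (1 - s * r) powr a) (at r within {0..1})" for r
    unfolding F_def
    using a_gt_1 by (auto intro!: derivative_eq_intros has_real_derivative_max0_powr_comp[THEN DERIV_cong])
  then have "((\<lambda>r. s * max 0 (1 - s * r) powr a) has_integral F 1 - F 0) {0..1}"
    by (intro has_integral_real_derivative) simp
  then have "s * chord_slope a s = F 1 - F 0"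
    by (simp add: chord_slope_def integral_unique flip: integral_mult_right)
  then show ?thesis by (simp add: F_def diff_divide_distrib)
qed

lemma chord_slope_1: "chord_slope a 1 = 1 / (a + 1)"
  using mult_chord_slope[of 1] by simp

lemma integrable_max0_powr_affine: "(\<lambda>r. max 0 (1 - s * r) powr a) integrable_on {0..1}"
  using a_gt_1 by (intro integrable_continuous_real continuous_on_max0_powr continuous_intros) auto

lemma chord_slope_nonneg: "0 \<le> chord_slope a s"
  unfolding chord_slope_def
  by (intro Henstock_Kurzweil_Integration.integral_nonneg integrable_max0_powr_affine) auto

lemma chord_slope_le_1:
  assumes "0 \<le> s"
  shows "chord_slope a s \<le> 1"
proof -
  have "chord_slope a s \<le> integral {0..1} (\<lambda>r::real. 1)"
    unfolding chord_slope_def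
    using a_gt_1 assms powr_mono2[of a _ 1] by (intro integral_le integrable_max0_powr_affine) auto
  then show ?thesis by simp
qed

lemma chord_slope_ge:
  assumes "0 \<le> s"
  shows "1 - a * s / 2 \<le> chord_slope a s"
proof -
  have "((\<lambda>r. 1 - a * s * r) has_integral (1 - a * s * 1\<^sup>2 / 2) - (0 - a * s * 0\<^sup>2 / 2)) {0..1}"
    by (rule has_integral_real_derivative) (auto intro!: derivative_eq_intros)
  moreover have "1 - a * s * r \<le> max 0 (1 - s * r) powr a" if "r \<in> {0..1}" for r
  proof -
    have "1 - a * s * r \<le> 1 + a * 1 powr (a - 1) * (max 0 (1 - s * r) - 1)"
      using a_gt_1 by (simp add: algebra_simps max_def)
    also have "\<dots> \<le> max 0 (1 - s * r) powr a"
      using powr_tangent_le[OF a_gt_1, of 1 "max 0 (1 - s * r)"] by simp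
    finally show ?thesis .
  qed
  ultimately show ?thesis
    unfolding chord_slope_def
    using integral_le[OF _ integrable_max0_powr_affine, of "\<lambda>r. 1 - a * s * r" s]
    by (auto simp: has_integral_iff)
qed

lemma has_real_derivative_chord_slope:
  "(chord_slope a has_real_derivative
    integral {0..1} (\<lambda>r. - (r * (a * max 0 (1 - s * r) powr (a - 1))))) (at s)"
proof -
  have "((\<lambda>s. integral (cbox 0 1) (\<lambda>r. max 0 (1 - s * r) powr a)) has_field_derivative
      integral (cbox 0 1) (\<lambda>r. - (r * (a * max 0 (1 - s * r) powr (a - 1))))) (at s within UNIV)"
  proof (rule leibniz_rule_field_derivative)
    show "((\<lambda>s. max 0 (1 - s * r) powr a) has_field_derivative
        - (r * (a * max 0 (1 - s * r) powr (a - 1)))) (at s within UNIV)" for s r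
      by (rule has_real_derivative_max0_powr_comp[OF a_gt_1, THEN DERIV_cong])
        (auto intro!: derivative_eq_intros)
    show "continuous_on (UNIV \<times> cbox 0 1) (\<lambda>(s, r). - (r * (a * max 0 (1 - s * r) powr (a - 1))))"
      unfolding case_prod_beta using a_gt_1 by (intro continuous_intros continuous_on_max0_powr) auto
  qed (use integrable_max0_powr_affine in auto)
  then show ?thesis by (simp add: chord_slope_def[abs_def])
qed

lemma continuous_on_chord_slope_comp:
  "continuous_on S f \<Longrightarrow> continuous_on S (\<lambda>x. chord_slope a (f x))"
  by (rule continuous_on_compose2[where g = "chord_slope a" and t = UNIV])
    (use has_real_derivative_chord_slope DERIV_isCont continuous_at_imp_continuous_on in blast)+

lemma chord_slope_add_mult_derivative:
  assumes "(chord_slope a has_real_derivative D) (at s)"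
  shows "chord_slope a s + s * D = max 0 (1 - s) powr a"
proof (rule DERIV_unique)
  show "((\<lambda>s. s * chord_slope a s) has_real_derivative chord_slope a s + s * D) (at s)"
    using DERIV_mult[OF DERIV_ident assms] by (simp add: ac_simps)
  show "((\<lambda>s. s * chord_slope a s) has_real_derivative max 0 (1 - s) powr a) (at s)"
    unfolding mult_chord_slope
    using a_gt_1 by (auto intro!: derivative_eq_intros has_real_derivative_max0_powr_comp[THEN DERIV_cong])
qed

lemma sqrt_diff_chord_slope_pos: "1 < \<kappa> \<Longrightarrow> 0 < sqrt (\<kappa> - chord_slope a (x\<^sup>2))"
  using chord_slope_le_1[of "x\<^sup>2"] by simp

lemma has_real_derivative_mult_sqrt_chord_slope:
  assumes \<kappa>_gt_1: "1 < \<kappa>"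
  shows "((\<lambda>x. x * sqrt (\<kappa> - chord_slope a (x\<^sup>2))) has_real_derivative
    (\<kappa> - max 0 (1 - x\<^sup>2) powr a) / sqrt (\<kappa> - chord_slope a (x\<^sup>2))) (at x)"
proof -
  obtain D where D: "(chord_slope a has_real_derivative D) (at (x\<^sup>2))"
    using has_real_derivative_chord_slope by blast
  let ?s = "sqrt (\<kappa> - chord_slope a (x\<^sup>2))"
  have pos: "0 < \<kappa> - chord_slope a (x\<^sup>2)" using sqrt_diff_chord_slope_pos[OF \<kappa>_gt_1, of x] by simp
  have "((\<lambda>x. chord_slope a (x\<^sup>2)) has_real_derivative D * (2 * x)) (at x)"
    by (rule DERIV_chain2[where g = "\<lambda>x. x\<^sup>2", OF D]) (auto intro!: derivative_eq_intros)
  then have "((\<lambda>x. x * sqrt (\<kappa> - chord_slope a (x\<^sup>2))) has_real_derivative ?s - x\<^sup>2 * D / ?s) (at x)"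
    using pos by (auto intro!: derivative_eq_intros simp: field_simps power2_eq_square)
  moreover have "?s - x\<^sup>2 * D / ?s = (?s\<^sup>2 - x\<^sup>2 * D) / ?s"
    using pos by (simp add: field_simps power2_eq_square)
  moreover have "?s\<^sup>2 - x\<^sup>2 * D = \<kappa> - max 0 (1 - x\<^sup>2) powr a"
    using pos chord_slope_add_mult_derivative[OF D] by simp
  ultimately show ?thesis by simp
qed

lemma unit_time_orbit_exists:
  assumes \<kappa>_gt_1: "1 < \<kappa>"
  obtains x where "\<And>t. (x has_real_derivative 2 * half_time a \<kappa> * sqrt (\<kappa> - chord_slope a ((x t)\<^sup>2))) (at t)"
    "\<And>t. x (1 - t) = - x t" "x 1 = 1"
proof -
  define g where "g = (\<lambda>x. sqrt (\<kappa> - chord_slope a (x\<^sup>2)))"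
  obtain X where deriv_X: "\<And>t. (X has_real_derivative g (X t)) (at t)" and X_odd: "\<And>t. X (- t) = - X t"
    and X_inverse: "\<And>x. 0 \<le> x \<Longrightarrow> X (integral {0..x} (\<lambda>s. 1 / g s)) = x"
  proof (rule odd_autonomous_solution_exists)
    show "continuous_on UNIV g"
      unfolding g_def by (intro continuous_intros continuous_on_chord_slope_comp)
    show "g x \<le> sqrt \<kappa>" for x unfolding g_def using chord_slope_nonneg by simp
    show "0 < g x" for x unfolding g_def by (rule sqrt_diff_chord_slope_pos[OF \<kappa>_gt_1])
  qed (auto simp: g_def)
  define x where "x = (\<lambda>t. X (half_time a \<kappa> * (2 * t - 1)))"
  show ?thesis
  proof (rule that[of x])
    show "(x has_real_derivative 2 * half_time a \<kappa> * sqrt (\<kappa> - chord_slope a ((x t)\<^sup>2))) (at t)" for t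
      unfolding x_def
      by (rule DERIV_chain2[OF deriv_X, THEN DERIV_cong]) (auto intro!: derivative_eq_intros simp: g_def)
    show "x (1 - t) = - x t" for t
      using X_odd[of "half_time a \<kappa> * (2 * t - 1)"] by (simp add: x_def algebra_simps)
    show "x 1 = 1" using X_inverse[of 1] by (simp add: x_def half_time_def g_def)
  qed
qed

end

text \<open>Taking the positive part makes the profile a solution on the whole line.\<close>
locale extremal_profile =
  fixes a H :: real and \<Psi> \<Psi>' :: "real \<Rightarrow> real"
  assumes exponent: "1 < a"
    and deriv_\<Psi>: "\<And>t. (\<Psi> has_real_derivative \<Psi>' t) (at t)"
    and deriv_\<Psi>': "\<And>t. (\<Psi>' has_real_derivative max 0 (\<Psi> t) powr a - 2 * H) (at t)"
    and \<Psi>_0: "\<Psi> 0 = 0"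
    and \<Psi>_symmetric: "\<And>t. \<Psi> (1 - t) = \<Psi> t"
    and concave: "\<And>t. max 0 (\<Psi> t) powr a < 2 * H"

lemma extremal_profile_of_amplitude:
  assumes a_gt_1: "1 < a" and \<kappa>_gt_1: "1 < \<kappa>" and m_pos: "0 < m"
    and m_powr: "m powr a = 8 * m * (half_time a \<kappa>)\<^sup>2"
  obtains \<Psi> \<Psi>' where "extremal_profile a (\<kappa> * m powr a / 2) \<Psi> \<Psi>'"
    "\<Psi>' 0 = 4 * m * half_time a \<kappa> * sqrt (\<kappa> - 1 / (a + 1))"
proof -
  define \<tau> g where "\<tau> = half_time a \<kappa>" and "g = (\<lambda>x. sqrt (\<kappa> - chord_slope a (x\<^sup>2)))"
  have g_pos: "0 < g x" for x unfolding g_def by (rule sqrt_diff_chord_slope_pos[OF a_gt_1 \<kappa>_gt_1])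
  obtain x where deriv_x: "\<And>t. (x has_real_derivative 2 * \<tau> * g (x t)) (at t)"
    and x_odd: "\<And>t. x (1 - t) = - x t" and x_1: "x 1 = 1"
    unfolding \<tau>_def g_def using unit_time_orbit_exists[OF a_gt_1 \<kappa>_gt_1] by blast
  have x_0: "x 0 = - 1" using x_odd[of 1] x_1 by simp
  define \<Psi> \<Psi>' where "\<Psi> = (\<lambda>t. m * (1 - (x t)\<^sup>2))" and "\<Psi>' = (\<lambda>t. - 4 * m * \<tau> * (x t * g (x t)))"
  have "max 0 (\<Psi> t) = m * max 0 (1 - (x t)\<^sup>2)" for t using m_pos by (simp add: \<Psi>_def max_mult_distrib_left)
  then have max0_\<Psi>: "max 0 (\<Psi> t) powr a = m powr a * max 0 (1 - (x t)\<^sup>2) powr a" for t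
    using m_pos by (simp add: powr_mult)
  have "extremal_profile a (\<kappa> * m powr a / 2) \<Psi> \<Psi>'"
  proof
    show "1 < a" by (rule a_gt_1)
    show "(\<Psi> has_real_derivative \<Psi>' t) (at t)" for t
      unfolding \<Psi>_def \<Psi>'_def by (rule derivative_eq_intros deriv_x refl)+ simp
    show "(\<Psi>' has_real_derivative max 0 (\<Psi> t) powr a - 2 * (\<kappa> * m powr a / 2)) (at t)" for t
    proof -
      define N where "N = \<kappa> - max 0 (1 - (x t)\<^sup>2) powr a"
      have "((\<lambda>t. x t * g (x t)) has_real_derivative N / g (x t) * (2 * \<tau> * g (x t))) (at t)"
        using DERIV_chain2[OF has_real_derivative_mult_sqrt_chord_slope[OF a_gt_1 \<kappa>_gt_1] deriv_x]
        by (simp add: N_def g_def)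
      then have "((\<lambda>t. x t * g (x t)) has_real_derivative 2 * \<tau> * N) (at t)"
        by (rule DERIV_cong) (use g_pos[of "x t"] in simp)
      from DERIV_cmult[OF this, of "- 4 * m * \<tau>"] show ?thesis
        unfolding \<Psi>'_def max0_\<Psi>
        by (rule DERIV_cong) (simp add: N_def m_powr \<tau>_def power2_eq_square algebra_simps)
    qed
    show "\<Psi> 0 = 0" by (simp add: \<Psi>_def x_0)
    show "\<Psi> (1 - t) = \<Psi> t" for t by (simp add: \<Psi>_def x_odd)
    show "max 0 (\<Psi> t) powr a < 2 * (\<kappa> * m powr a / 2)" for t
    proof -
      have "max 0 (1 - (x t)\<^sup>2) powr a \<le> 1" using a_gt_1 powr_mono2[of a "max 0 (1 - (x t)\<^sup>2)" 1] by simp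
      then show ?thesis
        using \<kappa>_gt_1 m_pos by (simp add: max0_\<Psi> mult.commute mult_strict_right_mono le_less_trans)
    qed
  qed
  moreover have "\<Psi>' 0 = 4 * m * half_time a \<kappa> * sqrt (\<kappa> - 1 / (a + 1))"
    by (simp add: \<Psi>'_def x_0 g_def \<tau>_def chord_slope_1[OF a_gt_1])
  ultimately show ?thesis by (rule that)
qed

definition amplitude :: "real \<Rightarrow> real \<Rightarrow> real" where
  "amplitude a \<kappa> = (8 * (half_time a \<kappa>)\<^sup>2) powr (1 / (a - 1))"

text \<open>The difference \<open>H - \<Psi>'(0)\<close> for the profile with \<open>2 H = \<kappa> m\<^sup>a\<close>, where \<open>m\<^bsup>a-1\<^esup> = 8 \<tau>\<^sup>2\<close> and
  \<open>\<tau> = half_time a \<kappa>\<close>.\<close>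
definition slope_deficit :: "real \<Rightarrow> real \<Rightarrow> real" where
  "slope_deficit a \<kappa> = 4 * amplitude a \<kappa> * half_time a \<kappa> * (\<kappa> * half_time a \<kappa> - sqrt (\<kappa> - 1 / (a + 1)))"

context
  fixes a :: real
  assumes a_gt_1: "1 < a"
begin

lemma continuous_on_inverse_sqrt_chord_slope:
  assumes "1 < \<kappa>"
  shows "continuous_on S (\<lambda>x. 1 / sqrt (\<kappa> - chord_slope a (x\<^sup>2)))"
  using sqrt_diff_chord_slope_pos[OF a_gt_1 assms]
  by (intro continuous_intros continuous_on_chord_slope_comp[OF a_gt_1]) (auto simp: less_le)

lemma continuous_on_half_time: "continuous_on {1<..} (half_time a)"
proof -
  have "continuous_on {1<..} (\<lambda>\<kappa>. integral (cbox 0 1) (\<lambda>x. 1 / sqrt (\<kappa> - chord_slope a (x\<^sup>2))))"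
  proof (rule integral_continuous_on_param)
    show "continuous_on ({1<..} \<times> cbox 0 1) (\<lambda>(\<kappa>, x). 1 / sqrt (\<kappa> - chord_slope a (x\<^sup>2)))"
      unfolding case_prod_beta using sqrt_diff_chord_slope_pos[OF a_gt_1]
      by (intro continuous_intros continuous_on_chord_slope_comp[OF a_gt_1]) (auto simp: less_le)
  qed
  then show ?thesis by (simp add: half_time_def[abs_def])
qed

lemma half_time_pos:
  assumes \<kappa>_gt_1: "1 < \<kappa>"
  shows "0 < half_time a \<kappa>"
proof -
  have "integral {0..1} (\<lambda>x::real. 1 / sqrt \<kappa>) \<le> half_time a \<kappa>"
    unfolding half_time_def
  proof (rule integral_le)
    show "1 / sqrt \<kappa> \<le> 1 / sqrt (\<kappa> - chord_slope a (x\<^sup>2))" for x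
      using chord_slope_nonneg[OF a_gt_1, of "x\<^sup>2"] sqrt_diff_chord_slope_pos[OF a_gt_1 \<kappa>_gt_1, of x]
      by (intro divide_left_mono) auto
  qed (auto intro!: integrable_continuous_real continuous_on_inverse_sqrt_chord_slope \<kappa>_gt_1)
  then have "1 / sqrt \<kappa> \<le> half_time a \<kappa>" by simp
  moreover have "0 < 1 / sqrt \<kappa>" using \<kappa>_gt_1 by simp
  ultimately show ?thesis by (rule less_le_trans[rotated])
qed

lemma half_time_le:
  assumes \<kappa>_gt_1: "1 < \<kappa>"
  shows "half_time a \<kappa> \<le> 1 / sqrt (\<kappa> - 1)"
proof -
  have "half_time a \<kappa> \<le> integral {0..1} (\<lambda>x::real. 1 / sqrt (\<kappa> - 1))"
    unfolding half_time_def
  proof (rule integral_le)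
    show "1 / sqrt (\<kappa> - chord_slope a (x\<^sup>2)) \<le> 1 / sqrt (\<kappa> - 1)" for x
      using chord_slope_le_1[OF a_gt_1, of "x\<^sup>2"] sqrt_diff_chord_slope_pos[OF a_gt_1 \<kappa>_gt_1, of x] \<kappa>_gt_1
      by (intro divide_left_mono) auto
  qed (auto intro!: integrable_continuous_real continuous_on_inverse_sqrt_chord_slope \<kappa>_gt_1)
  then show ?thesis by simp
qed

lemma ln_le_half_time:
  assumes d_pos: "0 < d"
  shows "ln (1 + a / d) / a \<le> half_time a (1 + d\<^sup>2)"
proof -
  have pos: "0 < d + a * x" if "x \<in> {0..1}" for x using d_pos a_gt_1 that by (simp add: add_pos_nonneg)
  have lower: "((\<lambda>x. 1 / (d + a * x)) has_integral ln (d + a * 1) / a - ln (d + a * 0) / a) {0..1}"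
    using pos a_gt_1 by (intro has_integral_real_derivative) (auto intro!: derivative_eq_intros)
  have pointwise: "1 / (d + a * x) \<le> 1 / sqrt (1 + d\<^sup>2 - chord_slope a (x\<^sup>2))" if x: "x \<in> {0..1}" for x
  proof -
    have "0 \<le> a * x\<^sup>2" using a_gt_1 by simp
    then have "1 + d\<^sup>2 - chord_slope a (x\<^sup>2) \<le> d\<^sup>2 + a * x\<^sup>2"
      using chord_slope_ge[OF a_gt_1, of "x\<^sup>2"] by simp
    also have "\<dots> \<le> d\<^sup>2 + (a * x)\<^sup>2"
      using a_gt_1 mult_right_mono[of a "a\<^sup>2" "x\<^sup>2"] by (simp add: power_mult_distrib self_le_power)
    also have "\<dots> \<le> (d + a * x)\<^sup>2" using a_gt_1 d_pos x by (simp add: power2_sum)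
    finally have "sqrt (1 + d\<^sup>2 - chord_slope a (x\<^sup>2)) \<le> d + a * x"
      using pos[OF x] by (intro real_le_lsqrt) auto
    then show ?thesis
      using sqrt_diff_chord_slope_pos[OF a_gt_1, of "1 + d\<^sup>2" x] pos[OF x] d_pos
      by (intro divide_left_mono) auto
  qed
  have "((\<lambda>x. 1 / sqrt (1 + d\<^sup>2 - chord_slope a (x\<^sup>2))) has_integral half_time a (1 + d\<^sup>2)) {0..1}"
    unfolding half_time_def using d_pos
    by (intro integrable_integral integrable_continuous_real continuous_on_inverse_sqrt_chord_slope) simp
  from has_integral_le[OF lower this pointwise]
  have "ln (d + a) / a - ln d / a \<le> half_time a (1 + d\<^sup>2)" by simp
  moreover have "1 + a / d = (d + a) / d" using d_pos by (simp add: field_simps)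
  ultimately show ?thesis using a_gt_1 d_pos by (simp add: ln_div diff_divide_distrib)
qed

lemma half_time_unbounded:
  assumes "0 \<le> N"
  obtains \<kappa> where "1 < \<kappa>" "\<kappa> \<le> 2" "N \<le> half_time a \<kappa>"
proof
  define d where "d = exp (- (a * N))"
  have d: "0 < d" "d \<le> 1" using a_gt_1 assms by (auto simp: d_def)
  then show "1 < 1 + d\<^sup>2" "1 + d\<^sup>2 \<le> 2" by (simp_all add: power_le_one)
  have "exp (a * N) \<le> 1 + a / d"
    using a_gt_1 by (simp add: d_def exp_minus divide_inverse mult_le_cancel_right1 add_increasing)
  then have "a * N \<le> ln (1 + a / d)" using a_gt_1 d by (simp add: ln_ge_iff add_pos_pos)
  then have "N \<le> ln (1 + a / d) / a" using a_gt_1 by (simp add: pos_le_divide_eq mult.commute)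
  also have "\<dots> \<le> half_time a (1 + d\<^sup>2)" by (rule ln_le_half_time[OF d(1)])
  finally show "N \<le> half_time a (1 + d\<^sup>2)" .
qed

lemma amplitude_pos: "1 < \<kappa> \<Longrightarrow> 0 < amplitude a \<kappa>"
  using half_time_pos[of \<kappa>] by (simp add: amplitude_def)

lemma amplitude_powr:
  assumes "1 < \<kappa>"
  shows "amplitude a \<kappa> powr a = 8 * amplitude a \<kappa> * (half_time a \<kappa>)\<^sup>2"
proof -
  have "amplitude a \<kappa> powr (a - 1) = 8 * (half_time a \<kappa>)\<^sup>2"
    using a_gt_1 by (simp add: amplitude_def powr_powr)
  then show ?thesis
    using powr_mult_base[of "amplitude a \<kappa>" "a - 1"] amplitude_pos[OF assms] by simp
qed

lemma continuous_on_slope_deficit: "continuous_on {1<..} (slope_deficit a)"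
  unfolding slope_deficit_def[abs_def] amplitude_def using half_time_pos
  by (intro continuous_intros continuous_on_half_time) (auto simp: less_le)

lemma slope_deficit_unbounded:
  assumes c_nonneg: "0 \<le> c"
  obtains \<kappa> where "1 < \<kappa>" "\<kappa> \<le> 2" "c \<le> slope_deficit a \<kappa>"
proof -
  obtain \<kappa> where \<kappa>: "1 < \<kappa>" "\<kappa> \<le> 2" and large: "2 + c \<le> half_time a \<kappa>"
    using half_time_unbounded[of "2 + c"] c_nonneg by auto
  define \<tau> m where "\<tau> = half_time a \<kappa>" and "m = amplitude a \<kappa>"
  have "2 + c \<le> \<tau>" using large by (simp add: \<tau>_def)
  have "1 \<le> \<tau>\<^sup>2" using \<open>2 + c \<le> \<tau>\<close> c_nonneg by (intro one_le_power) auto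
  then have "1 powr (1 / (a - 1)) \<le> m"
    unfolding m_def amplitude_def \<tau>_def[symmetric] using a_gt_1 by (intro powr_mono2) auto
  then have "1 * 1 \<le> (4 * m) * \<tau>" using \<open>2 + c \<le> \<tau>\<close> c_nonneg by (intro mult_mono) auto
  moreover have "c \<le> \<kappa> * \<tau> - sqrt (\<kappa> - 1 / (a + 1))"
  proof -
    have "0 \<le> 1 / (a + 1)" using a_gt_1 by simp
    then have "\<kappa> - 1 / (a + 1) \<le> 2\<^sup>2" using \<kappa> unfolding power2_eq_square by linarith
    then have "sqrt (\<kappa> - 1 / (a + 1)) \<le> 2" by (rule real_le_lsqrt[rotated]) simp
    moreover have "1 * \<tau> \<le> \<kappa> * \<tau>" using \<kappa> \<open>2 + c \<le> \<tau>\<close> c_nonneg by (intro mult_right_mono) auto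
    ultimately show ?thesis using \<open>2 + c \<le> \<tau>\<close> by simp
  qed
  ultimately have "1 * c \<le> slope_deficit a \<kappa>"
    unfolding slope_deficit_def \<tau>_def[symmetric] m_def[symmetric]
    using c_nonneg by (intro mult_mono) linarith+
  then show ?thesis using that \<kappa> by simp
qed

lemma slope_deficit_le:
  assumes \<kappa>_ge: "9 \<le> \<kappa>"
  shows "slope_deficit a \<kappa> \<le> 4 / (\<kappa> - 1)"
proof -
  define \<tau> m r where "\<tau> = half_time a \<kappa>" and "m = amplitude a \<kappa>" and "r = sqrt (\<kappa> - 1)"
  have r: "0 < r" "r\<^sup>2 = \<kappa> - 1" using \<kappa>_ge by (auto simp: r_def)
  have \<tau>: "0 < \<tau>" "\<tau> \<le> 1 / r" using half_time_pos[of \<kappa>] half_time_le[of \<kappa>] \<kappa>_ge by (auto simp: \<tau>_def r_def)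
  have "\<tau>\<^sup>2 \<le> (1 / r)\<^sup>2" using \<tau> by (intro power_mono) auto
  also have "\<dots> \<le> 1 / 8" using r \<kappa>_ge by (simp add: power_divide field_simps)
  finally have "m \<le> 1 powr (1 / (a - 1))"
    unfolding m_def amplitude_def \<tau>_def[symmetric] using a_gt_1 by (intro powr_mono2) auto
  moreover have m_pos: "0 < m" using amplitude_pos \<kappa>_ge by (simp add: m_def)
  ultimately have "4 * m * \<tau> * (1 / r) \<le> 4 * 1 * (1 / r) * (1 / r)" using \<tau> r by (intro mult_mono) auto
  moreover have "\<kappa> * \<tau> - sqrt (\<kappa> - 1 / (a + 1)) \<le> 1 / r"
  proof -
    have "1 / (a + 1) \<le> 1" using a_gt_1 by simp
    then have "r \<le> sqrt (\<kappa> - 1 / (a + 1))" unfolding r_def by (intro real_sqrt_le_mono) simp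
    moreover have "\<kappa> * \<tau> \<le> \<kappa> * (1 / r)" using \<tau> \<kappa>_ge by (intro mult_left_mono) auto
    moreover have "\<kappa> * (1 / r) = r + 1 / r" using r by (simp add: field_simps power2_eq_square)
    ultimately show ?thesis by simp
  qed
  then have "slope_deficit a \<kappa> \<le> 4 * m * \<tau> * (1 / r)"
    unfolding slope_deficit_def \<tau>_def[symmetric] m_def[symmetric] using \<tau> m_pos by (intro mult_left_mono) auto
  ultimately show ?thesis using r by (simp add: power2_eq_square)
qed

lemma slope_deficit_surj:
  assumes c_pos: "0 < c"
  obtains \<kappa> where "1 < \<kappa>" "slope_deficit a \<kappa> = c"
proof -
  obtain \<kappa>\<^sub>0 where \<kappa>\<^sub>0: "1 < \<kappa>\<^sub>0" "\<kappa>\<^sub>0 \<le> 2" "c \<le> slope_deficit a \<kappa>\<^sub>0"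
    using slope_deficit_unbounded[of c] c_pos by auto
  define \<kappa>\<^sub>1 where "\<kappa>\<^sub>1 = 9 + 4 / c"
  have "4 / (\<kappa>\<^sub>1 - 1) \<le> c" using c_pos by (simp add: \<kappa>\<^sub>1_def field_simps add_increasing)
  then have "slope_deficit a \<kappa>\<^sub>1 \<le> c" using slope_deficit_le[of \<kappa>\<^sub>1] c_pos by (simp add: \<kappa>\<^sub>1_def)
  moreover have "\<kappa>\<^sub>0 \<le> \<kappa>\<^sub>1" using \<kappa>\<^sub>0 c_pos by (simp add: \<kappa>\<^sub>1_def add_increasing2)
  moreover have "continuous_on {\<kappa>\<^sub>0..\<kappa>\<^sub>1} (slope_deficit a)"
    by (rule continuous_on_subset[OF continuous_on_slope_deficit]) (use \<kappa>\<^sub>0 in auto)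
  ultimately obtain \<kappa> where "\<kappa>\<^sub>0 \<le> \<kappa>" "slope_deficit a \<kappa> = c" using IVT2' \<kappa>\<^sub>0(3) by metis
  then show ?thesis using that[of \<kappa>] \<kappa>\<^sub>0(1) by simp
qed

theorem extremal_profile_exists:
  assumes c_pos: "0 < c"
  obtains H \<Psi> \<Psi>' where "extremal_profile a H \<Psi> \<Psi>'" "\<Psi>' 0 = H - c" "c < H"
proof -
  obtain \<kappa> where \<kappa>_gt_1: "1 < \<kappa>" and deficit: "slope_deficit a \<kappa> = c" using slope_deficit_surj[OF c_pos] .
  define \<tau> m where "\<tau> = half_time a \<kappa>" and "m = amplitude a \<kappa>"
  have m: "0 < m" "m powr a = 8 * m * \<tau>\<^sup>2"
    unfolding m_def \<tau>_def using amplitude_pos[OF \<kappa>_gt_1] amplitude_powr[OF \<kappa>_gt_1] by auto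
  obtain \<Psi> \<Psi>' where "extremal_profile a (\<kappa> * m powr a / 2) \<Psi> \<Psi>'"
    and \<Psi>'_0: "\<Psi>' 0 = 4 * m * \<tau> * sqrt (\<kappa> - 1 / (a + 1))"
    using extremal_profile_of_amplitude[OF a_gt_1 \<kappa>_gt_1 m(1)] m(2) unfolding \<tau>_def by metis
  moreover have "\<Psi>' 0 = \<kappa> * m powr a / 2 - c"
    unfolding \<Psi>'_0 deficit[symmetric] slope_deficit_def \<tau>_def[symmetric] m_def[symmetric] m(2)
    by (simp add: power2_eq_square algebra_simps)
  moreover have "0 < \<Psi>' 0"
  proof -
    have "1 / (a + 1) < 1" using a_gt_1 by simp
    then show ?thesis unfolding \<Psi>'_0 using m(1) half_time_pos[OF \<kappa>_gt_1] \<kappa>_gt_1 by (simp add: \<tau>_def)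
  qed
  ultimately show ?thesis using that[of "\<kappa> * m powr a / 2" \<Psi> \<Psi>'] by linarith
qed

end

section \<open>Properties of the profile\<close>

context extremal_profile
begin

lemma \<Psi>_1: "\<Psi> 1 = 0"
  using \<Psi>_symmetric[of 0] \<Psi>_0 by simp

lemma continuous_on_\<Psi>: "continuous_on S \<Psi>"
  using DERIV_isCont[OF deriv_\<Psi>] by (simp add: continuous_at_imp_continuous_on)

lemma continuous_on_\<Psi>': "continuous_on S \<Psi>'"
  using DERIV_isCont[OF deriv_\<Psi>'] by (simp add: continuous_at_imp_continuous_on)

lemma primitive_on_\<Psi>: "primitive_on u v \<Psi>' \<Psi>"
  by (intro has_real_derivative_imp_primitive_on has_field_derivative_at_within[OF deriv_\<Psi>] continuous_on_\<Psi>')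

lemma primitive_on_\<Psi>': "primitive_on u v (\<lambda>t. max 0 (\<Psi> t) powr a - 2 * H) \<Psi>'"
  using exponent
  by (intro has_real_derivative_imp_primitive_on has_field_derivative_at_within[OF deriv_\<Psi>'] continuous_intros
      continuous_on_max0_powr continuous_on_\<Psi>) auto

lemma \<Psi>'_antisymmetric: "\<Psi>' (1 - t) = - \<Psi>' t"
proof -
  have "((\<lambda>t. \<Psi> (1 - t)) has_real_derivative \<Psi>' (1 - t) * (- 1)) (at t)"
    by (rule DERIV_chain2[OF deriv_\<Psi>]) (auto intro!: derivative_eq_intros)
  then have "- \<Psi>' (1 - t) = \<Psi>' t" using DERIV_unique[OF _ deriv_\<Psi>] by (simp add: \<Psi>_symmetric)
  then show ?thesis by simp
qed

lemma \<Psi>'_less: "s < t \<Longrightarrow> \<Psi>' t < \<Psi>' s"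
  by (rule DERIV_neg_imp_decreasing) (use deriv_\<Psi>' concave in force)+

lemma \<Psi>'_pos:
  assumes "t < 1 / 2"
  shows "0 < \<Psi>' t"
  using \<Psi>'_less[OF assms] \<Psi>'_antisymmetric[of "1 / 2"] by simp

lemma strict_mono_on_\<Psi>: "strict_mono_on {..1 / 2} \<Psi>"
proof (rule strict_mono_onI)
  fix s t :: real assume st: "s \<in> {..1 / 2}" "t \<in> {..1 / 2}" "s < t"
  show "\<Psi> s < \<Psi> t"
  proof (rule DERIV_pos_imp_increasing_open[OF \<open>s < t\<close> _ continuous_on_\<Psi>])
    show "\<exists>d. (\<Psi> has_real_derivative d) (at x) \<and> 0 < d" if "s < x" "x < t" for x
      using deriv_\<Psi>[of x] \<Psi>'_pos[of x] st that by auto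
  qed
qed

lemma \<Psi>_pos:
  assumes t: "t \<in> {0<..<1}"
  shows "0 < \<Psi> t"
proof (cases "t \<le> 1 / 2")
  case True
  then show ?thesis using strict_mono_onD[OF strict_mono_on_\<Psi>, of 0 t] t \<Psi>_0 by simp
next
  case False
  then show ?thesis using strict_mono_onD[OF strict_mono_on_\<Psi>, of 0 "1 - t"] t \<Psi>_0 \<Psi>_symmetric[of t] by simp
qed

lemma \<Psi>_nonneg: "t \<in> {0..1} \<Longrightarrow> 0 \<le> \<Psi> t"
  using \<Psi>_pos[of t] \<Psi>_0 \<Psi>_1 by (cases "t = 0 \<or> t = 1") (auto intro: less_imp_le)

lemma tendsto_\<Psi>_divide: "((\<lambda>t. \<Psi> t / t) \<longlongrightarrow> \<Psi>' 0) (at_right 0)"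
  by (rule tendsto_divide_at_right_0[where b = 1]) (simp_all add: has_field_derivative_at_within deriv_\<Psi> \<Psi>_0)

lemma energy:
  "(\<Psi>' t)\<^sup>2 + 4 * H * \<Psi> t - 2 * max 0 (\<Psi> t) powr (a + 1) / (a + 1) = (\<Psi>' 0)\<^sup>2"
proof -
  have "((\<lambda>t. (\<Psi>' t)\<^sup>2 + 4 * H * \<Psi> t) has_real_derivative
      2 * \<Psi>' t * (max 0 (\<Psi> t) powr a - 2 * H) + 4 * H * \<Psi>' t) (at t)" for t
    by (auto intro!: derivative_eq_intros deriv_\<Psi> deriv_\<Psi>')
  moreover have "((\<lambda>t. 2 * max 0 (\<Psi> t) powr (a + 1) / (a + 1)) has_real_derivative
      2 * max 0 (\<Psi> t) powr a * \<Psi>' t) (at t)" for t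
    using exponent
    by (intro DERIV_cong[OF DERIV_cdivide[OF DERIV_cmult[OF
            has_real_derivative_max0_powr_comp[OF _ deriv_\<Psi>]]]]) auto
  ultimately have "((\<lambda>t. (\<Psi>' t)\<^sup>2 + 4 * H * \<Psi> t - 2 * max 0 (\<Psi> t) powr (a + 1) / (a + 1))
      has_real_derivative 0) (at t)" for t
    by (rule DERIV_cong[OF DERIV_diff]) (simp add: algebra_simps)
  from DERIV_isconst_all[of _ t 0, rule_format, OF this] show ?thesis using exponent by (simp add: \<Psi>_0)
qed

lemma LINT_\<Psi>_powr: "(LINT t:{0..1}|lborel. \<Psi> t powr a) = 2 * (H - \<Psi>' 0)"
proof -
  have "primitive_on 0 1 (\<lambda>_. 2 * H) (\<lambda>t. 2 * H * t)"
    by (intro has_real_derivative_imp_primitive_on) (auto intro!: derivative_eq_intros)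
  from primitive_on_LINT_eq[OF primitive_on_add[OF primitive_on_\<Psi>' this], of 0 1]
  have "(LINT t:{0..1}|lborel. max 0 (\<Psi> t) powr a) = 2 * (H - \<Psi>' 0)"
    using \<Psi>'_antisymmetric[of 0] by simp
  moreover have "(LINT t:{0..1}|lborel. max 0 (\<Psi> t) powr a) = (LINT t:{0..1}|lborel. \<Psi> t powr a)"
    by (rule set_lebesgue_integral_cong) (auto simp: \<Psi>_nonneg)
  ultimately show ?thesis by simp
qed

end

section \<open>Maximality\<close>

lemma Lq_on01_imp_set_integrable:
  assumes q_ge_1: "1 \<le> q" and V_Lq: "Lq_on01 q V"
  shows "set_integrable lborel {0..1} V"
proof (rule set_integrable_bound)
  show "set_integrable lborel {0..1} (\<lambda>t. 1 + \<bar>V t\<bar> powr q)"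
    using V_Lq borel_integrable_atLeastAtMost'[of 0 1 "\<lambda>_. 1::real"] by (auto simp: Lq_on01_def)
  have "\<bar>V t\<bar> \<le> 1 + \<bar>V t\<bar> powr q" for t
  proof (cases "\<bar>V t\<bar> \<le> 1")
    case False
    then have "\<bar>V t\<bar> powr 1 \<le> \<bar>V t\<bar> powr q" using q_ge_1 by (intro powr_mono) auto
    then show ?thesis using False by simp
  qed (simp add: add_increasing2)
  then show "AE t in lborel. t \<in> {0..1} \<longrightarrow> norm (V t) \<le> norm (1 + \<bar>V t\<bar> powr q)" by simp
qed (use V_Lq in \<open>simp add: Lq_on01_def\<close>)

lemma admissible_iff:
  assumes q_pos: "0 < q" and A_nonneg: "0 \<le> A"
  shows "admissible q A V \<longleftrightarrow> Lq_on01 q V \<and> (LINT t:{0..1}|lborel. \<bar>V t\<bar> powr q) \<le> A powr q"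
proof -
  define N where "N = (LINT t:{0..1}|lborel. \<bar>V t\<bar> powr q)"
  have N_nonneg: "0 \<le> N"
    unfolding N_def set_lebesgue_integral_def by (intro integral_nonneg_AE) (auto simp: indicator_def)
  have "N powr (1 / q) \<le> A \<longleftrightarrow> N \<le> A powr q"
  proof
    assume "N powr (1 / q) \<le> A"
    then have "(N powr (1 / q)) powr q \<le> A powr q" using q_pos by (intro powr_mono2) auto
    then show "N \<le> A powr q" using q_pos N_nonneg by (simp add: powr_powr)
  next
    assume "N \<le> A powr q"
    then have "N powr (1 / q) \<le> (A powr q) powr (1 / q)" using q_pos N_nonneg by (intro powr_mono2) auto
    then show "N powr (1 / q) \<le> A" using q_pos A_nonneg by (simp add: powr_powr)
  qed
  then show ?thesis by (simp add: admissible_def Lq_norm01_def N_def)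
qed

locale extremal_potential = extremal_profile "q / (q - 1)" H \<Psi> \<Psi>'
  for q H :: real and \<Psi> \<Psi>' +
  assumes slope_pos: "0 < \<Psi>' 0"
begin

definition coefficient :: real where
  "coefficient = q / (4 * q - 2)"

definition potential :: "real \<Rightarrow> real" where
  "potential t = coefficient * \<Psi> t powr (1 / (q - 1))"

lemma q_gt_1: "1 < q"
proof (rule ccontr)
  assume "\<not> 1 < q"
  then have "q / (q - 1) \<le> 1" by (cases "q = 1") (auto simp: divide_le_eq)
  then show False using exponent by simp
qed

lemma coefficient_pos: "0 < coefficient"
  using q_gt_1 by (simp add: coefficient_def)

lemma potential_nonneg: "0 \<le> potential t"
  unfolding potential_def using coefficient_pos by (intro mult_nonneg_nonneg) auto

lemma potential_0: "potential 0 = 0" and potential_1: "potential 1 = 0"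
  by (simp_all add: potential_def \<Psi>_0 \<Psi>_1)

lemma potential_symmetric: "potential (1 - t) = potential t"
  by (simp add: potential_def \<Psi>_symmetric)

lemma continuous_on_potential: "continuous_on {0..1} potential"
  unfolding potential_def using q_gt_1 \<Psi>_nonneg
  by (intro continuous_intros continuous_on_powr' continuous_on_\<Psi>) auto

lemma set_integrable_potential: "set_integrable lborel {0..1} potential"
  by (rule borel_integrable_atLeastAtMost'[OF continuous_on_potential])

lemma set_integrable_potential_powr: "set_integrable lborel {0..1} (\<lambda>t. potential t powr q)"
  using q_gt_1 potential_nonneg
  by (intro borel_integrable_atLeastAtMost' continuous_on_powr' continuous_on_potential continuous_intros)
    auto

lemma Lq_on01_potential: "Lq_on01 q potential"
  using set_integrable_potential set_integrable_potential_powr borel_measurable_integrable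
  by (simp add: Lq_on01_def potential_nonneg set_integrable_def set_borel_measurable_def)

lemma \<Psi>_eq_potential_powr:
  assumes "t \<in> {0..1}"
  shows "\<Psi> t = coefficient powr (1 - q) * potential t powr (q - 1)"
proof -
  have "potential t powr (q - 1) = coefficient powr (q - 1) * \<Psi> t"
    using coefficient_pos q_gt_1 \<Psi>_nonneg[OF assms] by (simp add: potential_def powr_mult powr_powr)
  then show ?thesis
    using coefficient_pos by (simp add: mult.assoc[symmetric] powr_add[symmetric])
qed

lemma LINT_potential_powr:
  "(LINT t:{0..1}|lborel. potential t powr q) = coefficient powr q * (2 * (H - \<Psi>' 0))"
proof -
  have "potential t powr q = coefficient powr q * \<Psi> t powr (q / (q - 1))" for t
    using coefficient_pos by (simp add: potential_def powr_mult powr_powr)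
  then show ?thesis by (simp add: LINT_\<Psi>_powr)
qed

lemma admissible_iff_LINT_le_potential:
  assumes "0 < A" and "2 * (H - \<Psi>' 0) = (A / coefficient) powr q"
  shows "admissible q A V \<longleftrightarrow> Lq_on01 q V \<and>
    (LINT t:{0..1}|lborel. \<bar>V t\<bar> powr q) \<le> (LINT t:{0..1}|lborel. potential t powr q)"
proof -
  have "(LINT t:{0..1}|lborel. potential t powr q) = A powr q"
    using assms coefficient_pos by (simp add: LINT_potential_powr powr_mult[symmetric])
  then show ?thesis using admissible_iff[of q A V] q_gt_1 \<open>0 < A\<close> by simp
qed

lemma riccati:
  assumes "t \<in> {0..1}"
  shows "2 * \<Psi> t * dirichlet_derivative potential t = (\<Psi>' t + \<Psi>' 0) * dirichlet_solution potential t"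
proof (rule riccati_of_first_integral[where \<Psi> = \<Psi>])
  define a where "a = q / (q - 1)"
  show "primitive_on 0 1 \<Psi>' \<Psi>" by (rule primitive_on_\<Psi>)
  show "primitive_on 0 1 (\<lambda>t. max 0 (\<Psi> t) powr a - 2 * H) \<Psi>'" unfolding a_def by (rule primitive_on_\<Psi>')
  fix s :: real assume s: "s \<in> {0<..<1}"
  show "\<Psi>' s \<le> \<Psi>' 0" using \<Psi>'_less[of 0 s] s by simp
  define P where "P = \<Psi> s powr (a + 1)"
  have "\<Psi> s * max 0 (\<Psi> s) powr a = P"
    using powr_mult_base[of "\<Psi> s" a] \<Psi>_pos[OF s] by (simp add: P_def add.commute)
  moreover have "potential s * (\<Psi> s)\<^sup>2 = coefficient * P"
  proof -
    have "(\<Psi> s)\<^sup>2 = \<Psi> s powr 2" using \<Psi>_pos[OF s] by (simp add: powr_numeral)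
    moreover have "P = \<Psi> s powr (1 / (q - 1)) * \<Psi> s powr 2"
      unfolding P_def powr_add[symmetric] using q_gt_1 by (simp add: a_def field_simps)
    ultimately show ?thesis by (simp add: potential_def)
  qed
  moreover have "2 * P / (a + 1) - 2 * P + 4 * (coefficient * P) = 0"
  proof -
    have "a + 1 = (2 * q - 1) / (q - 1)" using q_gt_1 by (simp add: a_def field_simps)
    then have "2 / (a + 1) = (2 * q - 2) / (2 * q - 1)" by simp
    moreover have "4 * coefficient = 2 * q / (2 * q - 1)"
      using q_gt_1 by (simp add: coefficient_def field_simps)
    moreover have "(2 * q - 2) / (2 * q - 1) - 2 + 2 * q / (2 * q - 1) = 0"
      using q_gt_1 by (simp add: field_simps)
    ultimately have "(2 / (a + 1) - 2 + 4 * coefficient) * P = 0" by simp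
    then show ?thesis by (simp add: algebra_simps)
  qed
  ultimately show "(\<Psi>' s)\<^sup>2 - 2 * \<Psi> s * (max 0 (\<Psi> s) powr a - 2 * H) + 4 * potential s * (\<Psi> s)\<^sup>2 = (\<Psi>' 0)\<^sup>2"
    using energy[of s] \<Psi>_pos[OF s] by (simp add: P_def a_def algebra_simps)
qed (use assms set_integrable_potential \<Psi>_0 \<Psi>_pos in auto)

lemma log_dirichlet_solution_le_pairing:
  assumes V_int: "set_integrable lborel {0..1} V" and V_nonneg: "\<And>t. t \<in> {0..1} \<Longrightarrow> 0 \<le> V t"
  shows "\<Psi>' 0 * (ln (dirichlet_solution V 1) - ln (dirichlet_solution potential 1))
    \<le> coefficient powr (1 - q) * (LINT t:{0..1}|lborel. potential t powr (q - 1) * (V t - potential t))"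
proof -
  have "0 < dirichlet_solution V t" "0 < dirichlet_solution potential t" if "t \<in> {0<..1}" for t
    using dirichlet_solution_ge[OF V_int V_nonneg, of t] that
      dirichlet_solution_ge[OF set_integrable_potential potential_nonneg, of t] by auto
  then have "\<Psi>' 0 * (ln (dirichlet_solution V 1) - ln (dirichlet_solution potential 1))
      \<le> (LINT t:{0..1}|lborel. \<Psi> t * (V t - potential t))"
    using V_int set_integrable_potential primitive_on_\<Psi> continuous_on_\<Psi>' \<Psi>_0 \<Psi>_1 \<Psi>_pos riccati
    by (intro log_dirichlet_solution_comparison) (auto intro: less_imp_le)
  also have "\<dots> = (LINT t:{0..1}|lborel. coefficient powr (1 - q) *
      (potential t powr (q - 1) * (V t - potential t)))"
    by (rule set_lebesgue_integral_cong) (auto simp: \<Psi>_eq_potential_powr)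
  finally show ?thesis by simp
qed

lemma dirichlet_solution_le_potential:
  assumes V_int: "set_integrable lborel {0..1} V" and V_nonneg: "\<And>t. t \<in> {0..1} \<Longrightarrow> 0 \<le> V t"
    and Vq_int: "set_integrable lborel {0..1} (\<lambda>t. V t powr q)"
    and norm_le: "(LINT t:{0..1}|lborel. V t powr q) \<le> (LINT t:{0..1}|lborel. potential t powr q)"
  shows "dirichlet_solution V 1 \<le> dirichlet_solution potential 1"
    and "dirichlet_solution V 1 = dirichlet_solution potential 1 \<Longrightarrow>
      AE t in lborel. t \<in> {0..1} \<longrightarrow> V t = potential t"
proof -
  define pairing where "pairing = (LINT t:{0..1}|lborel. potential t powr (q - 1) * (V t - potential t))"
  note log_le = log_dirichlet_solution_le_pairing[OF V_int V_nonneg, folded pairing_def]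
  have "set_integrable lborel {0..1} (\<lambda>t. (V t - potential t) * potential t powr (q - 1))"
    using q_gt_1 potential_nonneg
    by (intro set_integrable_mult_continuous_on set_integral_diff(1) V_int set_integrable_potential
        continuous_on_powr' continuous_on_potential continuous_intros) auto
  then have "set_integrable lborel {0..1} (\<lambda>t. potential t powr (q - 1) * (V t - potential t))"
    by (simp add: mult.commute)
  note tangent = set_integral_powr_tangent[OF q_gt_1 V_nonneg potential_nonneg Vq_int
      set_integrable_potential_powr this, folded pairing_def]
  have "q * pairing \<le> 0" using tangent(1) norm_le by simp
  then have pairing_le: "pairing \<le> 0" using q_gt_1 by (simp add: mult_le_0_iff)
  then have "coefficient powr (1 - q) * pairing \<le> 0" by (intro mult_nonneg_nonpos) auto
  with log_le have "\<Psi>' 0 * (ln (dirichlet_solution V 1) - ln (dirichlet_solution potential 1)) \<le> 0" by simp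
  then have "ln (dirichlet_solution V 1) \<le> ln (dirichlet_solution potential 1)"
    using slope_pos by (simp add: mult_le_0_iff)
  then show "dirichlet_solution V 1 \<le> dirichlet_solution potential 1"
    using dirichlet_solution_ge[OF V_int V_nonneg, of 1]
      dirichlet_solution_ge[OF set_integrable_potential potential_nonneg, of 1] by simp
  assume "dirichlet_solution V 1 = dirichlet_solution potential 1"
  then have "0 \<le> coefficient powr (1 - q) * pairing" using log_le by simp
  then have "pairing = 0" using coefficient_pos pairing_le by (simp add: zero_le_mult_iff)
  then show "AE t in lborel. t \<in> {0..1} \<longrightarrow> V t = potential t"
    using tangent norm_le by simp
qed

theorem det_T_le_det_T_potential:
  assumes V_Lq: "Lq_on01 q V"
    and norm_le: "(LINT t:{0..1}|lborel. \<bar>V t\<bar> powr q) \<le> (LINT t:{0..1}|lborel. potential t powr q)"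
  shows "det_T V \<le> det_T potential"
    and "det_T V = det_T potential \<Longrightarrow> AE t in lborel. t \<in> {0..1} \<longrightarrow> V t = potential t"
proof -
  have V_int: "set_integrable lborel {0..1} V"
    using q_gt_1 by (intro Lq_on01_imp_set_integrable[OF _ V_Lq]) simp
  note aV_int = set_integrable_abs[OF V_int]
  have "set_integrable lborel {0..1} (\<lambda>t. \<bar>V t\<bar> powr q)" using V_Lq by (simp add: Lq_on01_def)
  note nonneg_case = dirichlet_solution_le_potential[OF aV_int abs_ge_zero this norm_le]
  have abs_le: "dirichlet_solution V 1 \<le> dirichlet_solution (\<lambda>t. \<bar>V t\<bar>) 1"
    using abs_dirichlet_solution_le[OF V_int aV_int, of 1] by simp
  show "det_T V \<le> det_T potential"
    using abs_le nonneg_case(1) by (simp add: det_T_eq V_int set_integrable_potential)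
  assume "det_T V = det_T potential"
  then have "dirichlet_solution V 1 = dirichlet_solution (\<lambda>t. \<bar>V t\<bar>) 1"
    and "dirichlet_solution (\<lambda>t. \<bar>V t\<bar>) 1 = dirichlet_solution potential 1"
    using abs_le nonneg_case(1) by (simp_all add: det_T_eq V_int set_integrable_potential)
  from AE_eq_abs_if_dirichlet_solution_eq[OF V_int this(1)] nonneg_case(2)[OF this(2)]
  show "AE t in lborel. t \<in> {0..1} \<longrightarrow> V t = potential t" by eventually_elim auto
qed

end

section \<open>Regularity and endpoint behaviour\<close>

lemma smooth_on_if_derivative_closed:
  assumes S_open: "open S" and f_mem: "f \<in> \<F>"
    and derivative_closed: "\<And>f. f \<in> \<F> \<Longrightarrow> \<exists>f'\<in>\<F>. \<forall>t\<in>S. (f has_real_derivative f' t) (at t)"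
  shows "smooth_on S f"
proof -
  have transfer: "(h has_real_derivative d) (at t)"
    if "(g has_real_derivative d) (at t)" "\<forall>t\<in>S. h t = g t" "t \<in> S" for g h d t
    using that by (intro has_field_derivative_transform_within_open[OF that(1) S_open that(3)]) auto
  have "\<exists>g\<in>\<F>. \<forall>t\<in>S. (deriv ^^ k) f t = g t" for k
  proof (induction k)
    case 0
    then show ?case using f_mem by auto
  next
    case (Suc k)
    then obtain g where g: "g \<in> \<F>" "\<forall>t\<in>S. (deriv ^^ k) f t = g t" by blast
    obtain g' where g': "g' \<in> \<F>" "\<forall>t\<in>S. (g has_real_derivative g' t) (at t)"
      using derivative_closed[OF g(1)] by blast
    have "(deriv ^^ Suc k) f t = g' t" if "t \<in> S" for t
      using DERIV_imp_deriv[OF transfer[OF _ g(2) that]] g'(2) that by simp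
    then show ?case using g'(1) by blast
  qed
  then have "(deriv ^^ k) f differentiable (at t)" if "t \<in> S" for k t
    using derivative_closed transfer that by (meson real_differentiable_def)
  then show ?thesis by (simp add: smooth_on_def)
qed

inductive_set monomial_sums :: "(real \<Rightarrow> real) \<Rightarrow> (real \<Rightarrow> real) \<Rightarrow> (real \<Rightarrow> real) set" for f g where
  monomial: "(\<lambda>t. c * f t powr r * g t ^ n) \<in> monomial_sums f g"
| add: "h \<in> monomial_sums f g \<Longrightarrow> k \<in> monomial_sums f g \<Longrightarrow> (\<lambda>t. h t + k t) \<in> monomial_sums f g"

lemma smooth_on_powr_of_ode_solution:
  fixes f g :: "real \<Rightarrow> real"
  assumes S_open: "open S" and f_deriv: "\<And>t. t \<in> S \<Longrightarrow> (f has_real_derivative g t) (at t)"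
    and g_deriv: "\<And>t. t \<in> S \<Longrightarrow> (g has_real_derivative f t powr a - b) (at t)"
    and f_pos: "\<And>t. t \<in> S \<Longrightarrow> f t > 0"
  shows "smooth_on S (\<lambda>t. c * f t powr r)"
proof (rule smooth_on_if_derivative_closed[OF S_open, where \<F> = "monomial_sums f g"])
  show "(\<lambda>t. c * f t powr r) \<in> monomial_sums f g" using monomial_sums.monomial[of c f r g 0] by simp
  fix h assume "h \<in> monomial_sums f g"
  then show "\<exists>h'\<in>monomial_sums f g. \<forall>t\<in>S. (h has_real_derivative h' t) (at t)"
  proof induction
    case (monomial c r n)
    let ?h = "\<lambda>t. (c * r) * f t powr (r - 1) * g t ^ Suc n +
      ((c * n) * f t powr (r + a) * g t ^ (n - 1) + (- (c * n * b)) * f t powr r * g t ^ (n - 1))"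
    have "((\<lambda>t. c * f t powr r * g t ^ n) has_real_derivative ?h t) (at t)" if t: "t \<in> S" for t
    proof -
      have powr_deriv: "((\<lambda>t. c * f t powr r) has_real_derivative c * (r * f t powr (r - 1) * g t)) (at t)"
        by (rule DERIV_cmult[OF DERIV_chain2[OF has_real_derivative_powr[OF f_pos[OF t]] f_deriv[OF t]]])
      have power_deriv:
        "((\<lambda>t. g t ^ n) has_real_derivative of_nat n * (g t ^ (n - 1)) * (f t powr a - b)) (at t)"
        using DERIV_power[OF g_deriv[OF t], of n] by (simp add: mult.commute mult.left_commute)
      show ?thesis
        using DERIV_mult[OF powr_deriv power_deriv] by (rule DERIV_cong) (simp add: powr_add algebra_simps)
    qed
    moreover have "?h \<in> monomial_sums f g" by (intro monomial_sums.intros)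
    ultimately show ?case by (intro bexI[where x = ?h]) simp_all
  next
    case (add h k)
    then obtain h' k' where "h' \<in> monomial_sums f g" "k' \<in> monomial_sums f g"
      "\<forall>t\<in>S. (h has_real_derivative h' t) (at t)" "\<forall>t\<in>S. (k has_real_derivative k' t) (at t)" by blast
    then show ?case
      by (intro bexI[of _ "\<lambda>t. h' t + k' t"]) (auto intro: DERIV_add monomial_sums.add)
  qed
qed

lemma eventually_powr_divide_eq:
  fixes f :: "real \<Rightarrow> real"
  assumes "((\<lambda>t. f t / t) \<longlongrightarrow> v) (at_right 0)" "0 < v"
  shows "\<forall>\<^sub>F t in at_right 0. (f t / t) powr r * t powr (r - 1) = f t powr r / t"
  using order_tendstoD(1)[OF assms] eventually_at_right_less[of "0 :: real"]
  by eventually_elim (auto simp: powr_divide powr_diff zero_less_divide_iff)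

lemma tendsto_powr_divide_0:
  fixes f :: "real \<Rightarrow> real"
  assumes f_slope: "((\<lambda>t. f t / t) \<longlongrightarrow> v) (at_right 0)" and v_pos: "0 < v" and r_gt_1: "1 < r"
  shows "((\<lambda>t. f t powr r / t) \<longlongrightarrow> 0) (at_right 0)"
proof -
  have "((\<lambda>t::real. t powr (r - 1)) \<longlongrightarrow> 0 powr (r - 1)) (at_right 0)"
    using r_gt_1 by (intro tendsto_powr' tendsto_intros) (auto simp: eventually_at_filter)
  then have "((\<lambda>t. (f t / t) powr r * t powr (r - 1)) \<longlongrightarrow> v powr r * 0) (at_right 0)"
    using v_pos r_gt_1 by (intro tendsto_mult tendsto_powr f_slope) auto
  then show ?thesis
    using Lim_transform_eventually[OF _ eventually_powr_divide_eq[OF f_slope v_pos]] by simp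
qed

lemma filterlim_powr_divide_at_top:
  fixes f :: "real \<Rightarrow> real"
  assumes f_slope: "((\<lambda>t. f t / t) \<longlongrightarrow> v) (at_right 0)" and v_pos: "0 < v" and r_lt_1: "r < 1"
  shows "filterlim (\<lambda>t. f t powr r / t) at_top (at_right 0)"
proof -
  have "((\<lambda>t::real. t powr (1 - r)) \<longlongrightarrow> 0 powr (1 - r)) (at_right 0)"
    using r_lt_1 by (intro tendsto_powr' tendsto_intros) (auto simp: eventually_at_filter)
  then have "filterlim (\<lambda>t::real. inverse (t powr (1 - r))) at_top (at_right 0)"
    by (intro filterlim_inverse_at_top) (auto simp: eventually_at_filter)
  then have "filterlim (\<lambda>t::real. t powr (r - 1)) at_top (at_right 0)"
    by (simp add: powr_minus[symmetric])
  moreover have "((\<lambda>t. (f t / t) powr r) \<longlongrightarrow> v powr r) (at_right 0)"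
    using v_pos by (intro tendsto_intros f_slope) auto
  ultimately have "filterlim (\<lambda>t. (f t / t) powr r * t powr (r - 1)) at_top (at_right 0)"
    using v_pos by (intro filterlim_tendsto_pos_mult_at_top[where c = "v powr r"]) auto
  then show ?thesis
    using eventually_powr_divide_eq[OF f_slope v_pos]
    by (rule filterlim_mono_eventually[OF _ order_refl order_refl])
qed

lemma filterlim_at_left_to_right_0:
  "filterlim f F (at_left a) \<longleftrightarrow> filterlim (\<lambda>t. f (a - t)) F (at_right 0)" for a :: real
  by (simp add: filterlim_at_left_to_right filterlim_at_right_to_0[of "\<lambda>x. f (- x)" F "- a"])

lemma positive_if_nonzero:
  fixes f :: "real \<Rightarrow> real"
  assumes cont: "continuous_on {0..b} f" and f_slope: "((\<lambda>t. f t / t) \<longlongrightarrow> v) (at_right 0)" and v_pos: "0 < v"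
    and nonzero: "\<And>t. t \<in> {0<..<b} \<Longrightarrow> f t \<noteq> 0" and t: "t \<in> {0<..<b}"
  shows "0 < f t"
proof (rule ccontr)
  assume "\<not> 0 < f t"
  have "\<forall>\<^sub>F s in at_right 0. 0 < f s / s \<and> s \<in> {0<..<t}"
    using t by (intro eventually_conj order_tendstoD(1)[OF f_slope v_pos] eventually_at_right_real) auto
  then obtain s where s: "0 < f s / s" "0 < s" "s < t"
    using eventually_happens[of _ "at_right (0::real)"] by force
  then have "0 < f s" by (simp add: zero_less_divide_iff)
  moreover have "continuous_on {s..t} f" by (rule continuous_on_subset[OF cont]) (use s t in auto)
  ultimately obtain x where "s \<le> x" "x \<le> t" "f x = 0"
    using IVT2'[of f t 0 s] \<open>\<not> 0 < f t\<close> s by auto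
  then show False using nonzero[of x] s t by auto
qed

context extremal_potential
begin

lemma smooth_on_potential: "smooth_on {0<..<1} potential"
  unfolding potential_def[abs_def]
proof (rule smooth_on_powr_of_ode_solution)
  show "(\<Psi>' has_real_derivative \<Psi> t powr (q / (q - 1)) - 2 * H) (at t)" if "t \<in> {0<..<1}" for t
    using deriv_\<Psi>'[of t] \<Psi>_pos[OF that] by simp
qed (use deriv_\<Psi> \<Psi>_pos in auto)

lemma strict_mono_on_potential: "strict_mono_on {0..1 / 2} potential"
proof (rule strict_mono_onI)
  fix s t :: real assume "s \<in> {0..1 / 2}" "t \<in> {0..1 / 2}" "s < t"
  then have "\<Psi> s < \<Psi> t" "0 \<le> \<Psi> s" using strict_mono_onD[OF strict_mono_on_\<Psi>] \<Psi>_nonneg by auto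
  then show "potential s < potential t"
    unfolding potential_def using coefficient_pos q_gt_1 by (intro mult_strict_left_mono powr_less_mono2) auto
qed

lemma potential_has_derivative_at_right_0_iff:
  "(potential has_real_derivative d) (at_right 0)
    \<longleftrightarrow> ((\<lambda>t. coefficient * (\<Psi> t powr (1 / (q - 1)) / t)) \<longlongrightarrow> d) (at_right 0)"
  by (simp add: has_field_derivative_iff potential_0) (simp add: potential_def)

lemma potential_has_derivative_at_left_1:
  assumes "(potential has_real_derivative d) (at_right 0)"
  shows "(potential has_real_derivative - d) (at_left 1)"
proof -
  have "((\<lambda>t. - (potential t / t)) \<longlongrightarrow> - d) (at_right 0)"
    using assms by (intro tendsto_minus) (simp add: has_field_derivative_iff potential_0)
  then show ?thesis
    unfolding has_field_derivative_iff filterlim_at_left_to_right_0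
    by (simp add: potential_symmetric potential_1)
qed

lemma potential_derivative_lt_2:
  assumes "q < 2"
  shows "(potential has_real_derivative 0) (at_right 0)" "(potential has_real_derivative 0) (at_left 1)"
proof -
  have "1 < 1 / (q - 1)" using assms q_gt_1 by simp
  from tendsto_mult_left[OF tendsto_powr_divide_0[OF tendsto_\<Psi>_divide slope_pos this], of coefficient]
  show "(potential has_real_derivative 0) (at_right 0)"
    unfolding potential_has_derivative_at_right_0_iff by simp
  from potential_has_derivative_at_left_1[OF this]
  show "(potential has_real_derivative 0) (at_left 1)" by simp
qed

lemma potential_derivative_eq_2:
  assumes "q = 2"
  shows "\<exists>d>0. (potential has_real_derivative d) (at_right 0)"
    "\<exists>d<0. (potential has_real_derivative d) (at_left 1)"
proof -
  have pos: "0 < coefficient * \<Psi>' 0" using coefficient_pos slope_pos by simp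
  have deriv: "(potential has_real_derivative coefficient * \<Psi>' 0) (at_right 0)"
    unfolding potential_has_derivative_at_right_0_iff
  proof (rule Lim_transform_eventually)
    show "((\<lambda>t. coefficient * (\<Psi> t / t)) \<longlongrightarrow> coefficient * \<Psi>' 0) (at_right 0)"
      by (intro tendsto_mult_left tendsto_\<Psi>_divide)
    show "\<forall>\<^sub>F t in at_right 0. coefficient * (\<Psi> t / t) = coefficient * (\<Psi> t powr (1 / (q - 1)) / t)"
      using eventually_at_right_real[OF zero_less_one]
      by eventually_elim (use assms \<Psi>_pos in \<open>auto simp: less_imp_le\<close>)
  qed
  show "\<exists>d>0. (potential has_real_derivative d) (at_right 0)" using pos deriv by blast
  show "\<exists>d<0. (potential has_real_derivative d) (at_left 1)"
    using pos potential_has_derivative_at_left_1[OF deriv] by (intro exI[of _ "- (coefficient * \<Psi>' 0)"]) simp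
qed

lemma potential_derivative_gt_2:
  assumes "2 < q"
  shows "filterlim (\<lambda>t. (potential t - potential 0) / t) at_top (at_right 0)"
    "filterlim (\<lambda>t. (potential t - potential 1) / (t - 1)) at_bot (at_left 1)"
proof -
  have "1 / (q - 1) < 1" using assms by simp
  from filterlim_tendsto_pos_mult_at_top[OF tendsto_const coefficient_pos
      filterlim_powr_divide_at_top[OF tendsto_\<Psi>_divide slope_pos this]]
  show top: "filterlim (\<lambda>t. (potential t - potential 0) / t) at_top (at_right 0)"
    by (simp add: potential_0) (simp add: potential_def)
  then show "filterlim (\<lambda>t. (potential t - potential 1) / (t - 1)) at_bot (at_left 1)"
    unfolding filterlim_at_left_to_right_0
    by (simp add: potential_symmetric potential_0 potential_1 filterlim_uminus_at_top)
qed

lemma eq_\<Psi>_if_powr_eq: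
  assumes cont: "continuous_on {0..1} \<Phi>" and slope: "((\<lambda>t. \<Phi> t / t) \<longlongrightarrow> v) (at_right 0)" "0 < v"
    and powr_eq: "\<And>t. t \<in> {0..1} \<Longrightarrow> \<Phi> t powr r = \<Psi> t powr r" and r_nonzero: "r \<noteq> 0" and t: "t \<in> {0..1}"
  shows "\<Phi> t = \<Psi> t"
proof (cases "t \<in> {0<..<1}")
  case True
  have "0 < \<Phi> t"
  proof (rule positive_if_nonzero[OF cont slope _ True])
    show "\<Phi> s \<noteq> 0" if "s \<in> {0<..<1}" for s using powr_eq[of s] \<Psi>_pos[OF that] that by auto
  qed
  moreover have "(\<Phi> t powr r) powr (1 / r) = (\<Psi> t powr r) powr (1 / r)" using powr_eq[OF t] by simp
  ultimately show ?thesis using \<Psi>_pos[OF True] r_nonzero by (simp add: powr_powr)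
next
  case False
  then have "t = 0 \<or> t = 1" using t by auto
  then show ?thesis using powr_eq[OF t] \<Psi>_0 \<Psi>_1 by auto
qed

lemma psi_sol_unique:
  assumes \<Phi>: "psi_sol (q / (q - 1)) H\<^sub>1 c \<Phi>" and "c < H\<^sub>1"
    and potential_eq_\<Phi>: "\<forall>t\<in>{0..1}. potential t = q / (4 * q - 2) * \<Phi> t powr (1 / (q - 1))"
  shows "\<forall>t\<in>{0..1}. \<Phi> t = \<Psi> t" and "H\<^sub>1 - c = \<Psi>' 0"
proof -
  obtain \<Phi>' where deriv: "\<And>t. t \<in> {0..1} \<Longrightarrow> (\<Phi> has_real_derivative \<Phi>' t) (at t within {0..1})"
    and \<Phi>_0: "\<Phi> 0 = 0" "\<Phi>' 0 = H\<^sub>1 - c"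
    using \<Phi> unfolding psi_sol_def by blast
  have cont: "continuous_on {0..1} \<Phi>"
    using deriv DERIV_continuous unfolding continuous_on_eq_continuous_within by blast
  have slope: "((\<lambda>t. \<Phi> t / t) \<longlongrightarrow> H\<^sub>1 - c) (at_right 0)"
    using deriv[of 0] \<Phi>_0 by (intro tendsto_divide_at_right_0[where b = 1]) auto
  have "\<Phi> t powr (1 / (q - 1)) = \<Psi> t powr (1 / (q - 1))" if "t \<in> {0..1}" for t
    using potential_eq_\<Phi> that coefficient_pos unfolding potential_def coefficient_def[symmetric] by auto
  then show eq_\<Psi>: "\<forall>t\<in>{0..1}. \<Phi> t = \<Psi> t"
    using q_gt_1 \<open>c < H\<^sub>1\<close> by (intro ballI eq_\<Psi>_if_powr_eq[OF cont slope]) auto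
  have "\<forall>\<^sub>F t in at_right 0. \<Phi> t / t = \<Psi> t / t"
    using eventually_at_right_real[OF zero_less_one] by eventually_elim (use eq_\<Psi> in auto)
  then have "((\<lambda>t. \<Psi> t / t) \<longlongrightarrow> H\<^sub>1 - c) (at_right 0)" by (rule Lim_transform_eventually[OF slope])
  then show "H\<^sub>1 - c = \<Psi>' 0" using tendsto_\<Psi>_divide by (rule tendsto_unique[rotated]) simp
qed

lemma psi_sol_\<Psi>: "psi_sol (q / (q - 1)) H (H - \<Psi>' 0) \<Psi>"
  unfolding psi_sol_def
proof (intro exI[of _ \<Psi>'] conjI ballI)
  fix t :: real assume "t \<in> {0..1}"
  then show "(\<Psi>' has_real_derivative \<bar>\<Psi> t\<bar> powr (q / (q - 1)) - 2 * H) (at t within {0..1})"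
    using has_field_derivative_at_within[OF deriv_\<Psi>', of t] \<Psi>_nonneg[of t] by simp
qed (simp_all add: has_field_derivative_at_within[OF deriv_\<Psi>] \<Psi>_0)

lemma potential_eq: "potential t = q / (4 * q - 2) * \<Psi> t powr (1 / (q - 1))"
  by (simp add: potential_def coefficient_def)

end

section \<open>The maximization problem\<close>

theorem theoremB:
  fixes q A :: real
  assumes "q > 1" and "A > 0"
  defines "\<alpha> \<equiv> q / (q - 1)"
      and "c \<equiv> (1/2) * (A * (4 * q - 2) / q) powr q"
  shows "\<exists>VA.
     admissible q A VA \<and>
     (\<forall>V. admissible q A V \<longrightarrow> det_T V \<le> det_T VA) \<and>
     (\<forall>V. admissible q A V \<and> det_T V = det_T VA \<longrightarrow>
          (AE t in lborel. t \<in> {0..1} \<longrightarrow> V t = VA t)) \<and>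
     (\<exists>!H. H > c \<and> (\<exists>\<Psi>. psi_sol \<alpha> H c \<Psi> \<and>
            (\<forall>t\<in>{0..1}. VA t = q / (4 * q - 2) * \<Psi> t powr (1 / (q - 1))))) \<and>
     (\<forall>H \<Psi>. H > c \<and> psi_sol \<alpha> H c \<Psi> \<and>
            (\<forall>t\<in>{0..1}. VA t = q / (4 * q - 2) * \<Psi> t powr (1 / (q - 1)))
            \<longrightarrow> (\<forall>t\<in>{0..1}. \<Psi> t \<ge> 0)) \<and>
     (\<forall>t\<in>{0..1}. VA (1 - t) = VA t) \<and>
     smooth_on {0<..<1} VA \<and>
     strict_mono_on {0..1/2} VA \<and>
     (q < 2 \<longrightarrow> (VA has_real_derivative 0) (at_right 0) \<and>
                 (VA has_real_derivative 0) (at_left 1)) \<and>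
     (q = 2 \<longrightarrow> (\<exists>d>0. (VA has_real_derivative d) (at_right 0)) \<and>
                 (\<exists>d<0. (VA has_real_derivative d) (at_left 1))) \<and>
     (q > 2 \<longrightarrow> filterlim (\<lambda>t. (VA t - VA 0) / t) at_top (at_right 0) \<and>
                 filterlim (\<lambda>t. (VA t - VA 1) / (t - 1)) at_bot (at_left 1))"
proof -
  have \<alpha>_gt_1: "1 < \<alpha>" using \<open>q > 1\<close> by (simp add: \<alpha>_def)
  have c_pos: "0 < c" using \<open>q > 1\<close> \<open>A > 0\<close> by (simp add: c_def)
  obtain H \<Psi> \<Psi>' where profile: "extremal_profile \<alpha> H \<Psi> \<Psi>'" and slope: "\<Psi>' 0 = H - c" and "c < H"
    using extremal_profile_exists[OF \<alpha>_gt_1 c_pos] .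
  interpret extremal_potential q H \<Psi> \<Psi>'
    using profile slope \<open>c < H\<close> by (simp add: extremal_potential_def extremal_potential_axioms_def \<alpha>_def)
  have "2 * (H - \<Psi>' 0) = (A / coefficient) powr q" by (simp add: slope c_def coefficient_def)
  note admissible = admissible_iff_LINT_le_potential[OF \<open>A > 0\<close> this]
  have unique: "H\<^sub>1 = H \<and> (\<forall>t\<in>{0..1}. 0 \<le> \<Phi> t)"
    if "c < H\<^sub>1" "psi_sol \<alpha> H\<^sub>1 c \<Phi>"
      "\<forall>t\<in>{0..1}. potential t = q / (4 * q - 2) * \<Phi> t powr (1 / (q - 1))" for H\<^sub>1 \<Phi>
    using psi_sol_unique[of H\<^sub>1 c \<Phi>] that slope \<Psi>_nonneg by (simp add: \<alpha>_def)
  have \<Psi>_sol: "psi_sol \<alpha> H c \<Psi>" using psi_sol_\<Psi> slope by (simp add: \<alpha>_def)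
  show ?thesis
  proof (intro exI[of _ potential] conjI)
    show "\<exists>!H. H > c \<and> (\<exists>\<Psi>. psi_sol \<alpha> H c \<Psi> \<and>
        (\<forall>t\<in>{0..1}. potential t = q / (4 * q - 2) * \<Psi> t powr (1 / (q - 1))))"
      using \<open>c < H\<close> \<Psi>_sol potential_eq unique by (intro ex1I[of _ H]) blast+
    show "admissible q A potential" by (simp add: admissible Lq_on01_potential potential_nonneg)
  qed (use det_T_le_det_T_potential unique potential_symmetric smooth_on_potential strict_mono_on_potential
      potential_derivative_lt_2 potential_derivative_eq_2 potential_derivative_gt_2
      in \<open>simp_all add: admissible\<close>, blast)
qed

end
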